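(* Let $p:\underline{E}\to\underline{B}$ and $p':\underline{E}'\to\underline{B}$ be directed weak fibrations. Then a d-map $f:\underline{E}\to\underline{E}'$ over $\underline{B}$ (i.e. with $p'\circ f=p$) is a directed fibre homotopy equivalence if and only if it is an ordinary directed homotopy equivalence.
   Context: A d-space $\underline{X}$ is a topological space $|\underline{X}|$ together with a set $d\underline{X}$ of continuous maps $[0,1]\to|\underline{X}|$ (directed paths, or d-paths) containing all constant paths and closed under precomposition with weakly increasing continuous maps $[0,1]\to[0,1]$ and under concatenation. A d-map $f:\underline{X}\to\underline{Y}$ is a continuous map with $f\circ a\in d\underline{Y}$ for all $a\in d\underline{X}$. $\uparrow\mathbf{I}$ is $[0,1]$ with the weakly increasing continuous maps $[0,1]\to[0,1]$ as d-paths. A path in a product of d-spaces is directed iff its components are; for $\alpha\in\{0,1\}$, $\partial^\alpha:\underline{X}\to\underline{X}\times\uparrow\mathbf{I}$ is $\partial^\alpha(x)=(x,\alpha)$. A directed homotopy (d-homotopy) from $f$ to $g$, written $f\preceq_d g$, is a d-map $\varphi:\underline{X}\times\uparrow\mathbf{I}\to\underline{Y}$ with $\varphi\circ\partial^0=f$, $\varphi\circ\partial^1=g$; $\simeq_d$ is the equivalence relation generated by $\preceq_d$ (finite zigzags of d-homotopies). Vertical d-homotopy: for d-maps $p:\underline{E}\to\underline{B}$ and $f,g:\underline{X}\to\underline{E}$ with $p\circ f=p\circ g$, write $f\simeq_d^{(p)}g$ if there is a finite sequence of d-maps $f=f_0,f_1,\dots,f_n=g:\underline{X}\to\underline{E}$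 with $p\circ f_k=p\circ f$ and, for each $k$, a d-homotopy $\varphi_k$ either from $f_{k-1}$ to $f_k$ or from $f_k$ to $f_{k-1}$, with $p(\varphi_k(x,t))=p(f(x))$ for all $x,t$. A d-map $p:\underline{E}\to\underline{B}$ is a directed weak fibration if for every d-space $\underline{X}$, all d-maps $f':\underline{X}\to\underline{E}$, $\varphi:\underline{X}\times\uparrow\mathbf{I}\to\underline{B}$ and all $\alpha\in\{0,1\}$ with $\varphi\circ\partial^\alpha=p\circ f'$, there is a d-map $\varphi':\underline{X}\times\uparrow\mathbf{I}\to\underline{E}$ with $p\circ\varphi'=\varphi$ and $\varphi'\circ\partial^\alpha\simeq_d^{(p)}f'$. A d-map $f:\underline{E}\to\underline{E}'$ is an (ordinary) directed homotopy equivalence if there is a d-map $f':\underline{E}'\to\underline{E}$ with $f'\circ f\simeq_d \mathrm{id}_{\underline{E}}$ and $f\circ f'\simeq_d\mathrm{id}_{\underline{E}'}$. A d-map $f:\underline{E}\to\underline{E}'$ with $p'\circ f=p$ is a directed fibre homotopy equivalence if there is a d-map $g:\underline{E}'\to\underline{E}$ with $p\circ g=p'$, $g\circ f\simeq_d^{(p)}\mathrm{id}_{\underline{E}}$ and $f\circ g\simeq_d^{(p')}\mathrm{id}_{\underline{E}'}$. *)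

theory Defs
  imports "HOL-Analysis.Analysis"
begin

section \<open>d-spaces\<close>

text \<open>
  As with \<^const>\<open>pathin\<close>, a path is a total function on the reals of which only the values
  on \<open>{0..1}\<close> matter.  The last closure condition in \<open>is_dspace\<close> expresses
  exactly this; without it, being a d-path could depend on junk values outside \<open>{0..1}\<close>.
\<close>

definition dconcat :: "(real \<Rightarrow> 'a) \<Rightarrow> (real \<Rightarrow> 'a) \<Rightarrow> real \<Rightarrow> 'a" where
  "dconcat a b = (\<lambda>t. if t \<le> 1/2 then a (2 * t) else b (2 * t - 1))"

definition dinterval_paths :: "(real \<Rightarrow> real) set" where
  "dinterval_paths = {h. continuous_map (top_of_set {0..1}) (top_of_set {0..1}) h \<and> mono_on {0..1} h}"

definition is_dspace :: "'a topology \<Rightarrow> (real \<Rightarrow> 'a) set \<Rightarrow> bool" where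
  "is_dspace T D \<longleftrightarrow>
     (\<forall>a\<in>D. pathin T a) \<and>
     (\<forall>x\<in>topspace T. (\<lambda>t. x) \<in> D) \<and>
     (\<forall>a\<in>D. \<forall>h\<in>dinterval_paths. a \<circ> h \<in> D) \<and>
     (\<forall>a\<in>D. \<forall>b\<in>D. a 1 = b 0 \<longrightarrow> dconcat a b \<in> D) \<and>
     (\<forall>a\<in>D. \<forall>b. (\<forall>t\<in>{0..1}. b t = a t) \<longrightarrow> b \<in> D)"

lemma is_dspaceI:
  assumes "\<And>a. a \<in> D \<Longrightarrow> pathin T a"
    and "\<And>x. x \<in> topspace T \<Longrightarrow> (\<lambda>t. x) \<in> D"
    and "\<And>a h. a \<in> D \<Longrightarrow> h \<in> dinterval_paths \<Longrightarrow> a \<circ> h \<in> D"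
    and "\<And>a b. a \<in> D \<Longrightarrow> b \<in> D \<Longrightarrow> a 1 = b 0 \<Longrightarrow> dconcat a b \<in> D"
    and "\<And>a b. a \<in> D \<Longrightarrow> (\<And>t. 0 \<le> t \<Longrightarrow> t \<le> 1 \<Longrightarrow> b t = a t) \<Longrightarrow> b \<in> D"
  shows "is_dspace T D"
proof -
  have 5: "b \<in> D" if "a \<in> D" "\<forall>t\<in>{0..1}. b t = a t" for a b
    by (rule assms(5)[OF that(1)], rule bspec[OF that(2)]) simp
  show ?thesis
    unfolding is_dspace_def
    by (intro conjI ballI allI impI; (rule assms(1-4) 5, assumption+))
qed

typedef 'a dspace = "{(T :: 'a topology, D). is_dspace T D}"
proof
  have "is_dspace (discrete_topology {}) ({} :: (real \<Rightarrow> 'a) set)"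
    by (simp add: is_dspace_def)
  then show "(discrete_topology {}, {}) \<in> {(T :: 'a topology, D). is_dspace T D}"
    by simp
qed

definition dtop :: "'a dspace \<Rightarrow> 'a topology" where
  "dtop X = fst (Rep_dspace X)"

definition dpaths :: "'a dspace \<Rightarrow> (real \<Rightarrow> 'a) set" where
  "dpaths X = snd (Rep_dspace X)"

abbreviation dpoints :: "'a dspace \<Rightarrow> 'a set" where
  "dpoints X \<equiv> topspace (dtop X)"

definition mk_dspace :: "'a topology \<Rightarrow> (real \<Rightarrow> 'a) set \<Rightarrow> 'a dspace" where
  "mk_dspace T D = Abs_dspace (T, D)"

lemma is_dspace: "is_dspace (dtop X) (dpaths X)"
  using Rep_dspace[of X] by (auto simp: dtop_def dpaths_def)

lemma mk_dspace:
  assumes "is_dspace T D"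
  shows "dtop (mk_dspace T D) = T" "dpaths (mk_dspace T D) = D"
  using assms by (simp_all add: mk_dspace_def dtop_def dpaths_def Abs_dspace_inverse)

lemma
  assumes "a \<in> dpaths X"
  shows dpath_pathin: "pathin (dtop X) a"
    and dpath_reparam: "h \<in> dinterval_paths \<Longrightarrow> a \<circ> h \<in> dpaths X"
    and dpath_concat: "b \<in> dpaths X \<Longrightarrow> a 1 = b 0 \<Longrightarrow> dconcat a b \<in> dpaths X"
    and dpath_cong: "(\<And>t. 0 \<le> t \<Longrightarrow> t \<le> 1 \<Longrightarrow> b t = a t) \<Longrightarrow> b \<in> dpaths X"
  using is_dspace[of X] assms unfolding is_dspace_def by auto

lemma dpath_const: "x \<in> dpoints X \<Longrightarrow> (\<lambda>t. x) \<in> dpaths X"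
  using is_dspace[of X] unfolding is_dspace_def by auto

lemma dpath_reparam': "a \<in> dpaths X \<Longrightarrow> h \<in> dinterval_paths \<Longrightarrow> (\<lambda>t. a (h t)) \<in> dpaths X"
  using dpath_reparam[of a X h] by (simp add: o_def)

lemma dpath_in: "a \<in> dpaths X \<Longrightarrow> 0 \<le> t \<Longrightarrow> t \<le> 1 \<Longrightarrow> a t \<in> dpoints X"
  using dpath_pathin[of a X] by (auto simp: pathin_def continuous_map_def)

lemma dinterval_paths_iff:
  "h \<in> dinterval_paths \<longleftrightarrow> continuous_on {0..1} h \<and> h ` {0..1} \<subseteq> {0..1} \<and> mono_on {0..1} h"
  by (auto simp: dinterval_paths_def)

lemma dinterval_path_bounds:
  assumes "h \<in> dinterval_paths" "0 \<le> t" "t \<le> 1"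
  shows "0 \<le> h t" "h t \<le> 1"
  using assms by (auto simp: dinterval_paths_iff image_subset_iff)

lemma continuous_on_dconcat_aux:
  fixes u v :: "real \<Rightarrow> 'a::topological_space"
  assumes "continuous_on {0..c} u" "continuous_on {c..1} v" "u c = v c"
    and "0 \<le> c" "c \<le> 1"
  shows "continuous_on {0..1} (\<lambda>t. if t \<le> c then u t else v t)"
proof -
  have "{0..1} = {0..c} \<union> {c..1}"
    using assms by auto
  moreover have "continuous_on ({0..c} \<union> {c..1}) (\<lambda>t. if t \<le> c then u t else v t)"
    by (rule continuous_on_cases) (use assms in auto)
  ultimately show ?thesis by metis
qed

lemma pathin_dconcat:
  assumes a: "pathin T a" and b: "pathin T b" and eq: "a 1 = b 0"
  shows "pathin T (dconcat a b)"
  unfolding pathin_def dconcat_def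
proof (rule continuous_map_cases_le)
  show "continuous_map (top_of_set {0..1}) euclideanreal (\<lambda>t. t)"
    "continuous_map (top_of_set {0..1}) euclideanreal (\<lambda>t. 1/2)"
    by auto
  have "continuous_map (subtopology (top_of_set {0..1}) {x \<in> topspace (top_of_set {0..1}). x \<le> 1 / 2})
     (top_of_set {0..1::real}) (\<lambda>x. 2 * x)"
    by (auto simp: subtopology_subtopology intro!: continuous_intros)
  from continuous_map_compose[OF this a[unfolded pathin_def]]
  show "continuous_map (subtopology (top_of_set {0..1}) {x \<in> topspace (top_of_set {0..1}). x \<le> 1 / 2})
     T (\<lambda>x. a (2 * x))"
    by (simp add: o_def)
  have "continuous_map (subtopology (top_of_set {0..1}) {x \<in> topspace (top_of_set {0..1}). 1 / 2 \<le> x})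
     (top_of_set {0..1::real}) (\<lambda>x. 2 * x - 1)"
    by (auto simp: subtopology_subtopology intro!: continuous_intros)
  from continuous_map_compose[OF this b[unfolded pathin_def]]
  show "continuous_map (subtopology (top_of_set {0..1}) {x \<in> topspace (top_of_set {0..1}). 1 / 2 \<le> x})
     T (\<lambda>x. b (2 * x - 1))"
    by (simp add: o_def)
  show "a (2 * x) = b (2 * x - 1)" if "x \<in> topspace (top_of_set {0..1})" "x = 1 / 2" for x
    unfolding that(2) using eq by simp
qed

lemma pathin_cong: "pathin T a \<Longrightarrow> (\<And>t. 0 \<le> t \<Longrightarrow> t \<le> 1 \<Longrightarrow> b t = a t) \<Longrightarrow> pathin T b"
  unfolding pathin_def by (erule continuous_map_eq) simp

lemma is_dspace_dinterval: "is_dspace (top_of_set {0..1}) dinterval_paths"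
proof (rule is_dspaceI)
  fix a h assume a: "a \<in> dinterval_paths" and h: "h \<in> dinterval_paths"
  have "continuous_map (top_of_set {0..1}) (top_of_set {0..1}) (a \<circ> h)"
    using a h unfolding dinterval_paths_def by (blast intro: continuous_map_compose)
  moreover have "mono_on {0..1} (a \<circ> h)"
  proof (rule mono_onI)
    fix r s :: real assume rs: "r \<in> {0..1}" "s \<in> {0..1}" "r \<le> s"
    have "h r \<in> {0..1}" "h s \<in> {0..1}"
      using dinterval_path_bounds[OF h] rs by auto
    moreover have "h r \<le> h s"
      using h rs by (auto simp: dinterval_paths_iff mono_on_def)
    ultimately show "(a \<circ> h) r \<le> (a \<circ> h) s"
      using a by (simp add: dinterval_paths_iff mono_on_def)
  qed
  ultimately show "a \<circ> h \<in> dinterval_paths"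
    by (simp add: dinterval_paths_def)
next
  fix a b assume a: "a \<in> dinterval_paths" and b: "b \<in> dinterval_paths" and eq: "a 1 = b 0"
  have "pathin (top_of_set {0..1}) (dconcat a b)"
    using a b eq by (intro pathin_dconcat) (auto simp: pathin_def dinterval_paths_def)
  moreover have "mono_on {0..1} (dconcat a b)"
  proof (rule mono_onI)
    fix r s :: real assume rs: "r \<in> {0..1}" "s \<in> {0..1}" "r \<le> s"
    have am: "a x \<le> a y" and bm: "b x \<le> b y" if "0 \<le> x" "x \<le> y" "y \<le> 1" for x y
      using a b that by (auto simp: dinterval_paths_iff mono_on_def)
    have "a (2 * r) \<le> b (2 * s - 1)" if "r \<le> 1/2" "\<not> s \<le> 1/2"
      using am[of "2 * r" 1] bm[of 0 "2 * s - 1"] rs that eq by auto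
    then show "dconcat a b r \<le> dconcat a b s"
      using rs am bm by (auto simp: dconcat_def)
  qed
  ultimately show "dconcat a b \<in> dinterval_paths"
    by (auto simp: dinterval_paths_def pathin_def)
next
  fix a b :: "real \<Rightarrow> real"
  assume a: "a \<in> dinterval_paths" and ab: "\<And>t. 0 \<le> t \<Longrightarrow> t \<le> 1 \<Longrightarrow> b t = a t"
  have "pathin (top_of_set {0..1}) b"
    using a by (intro pathin_cong[OF _ ab]) (auto simp: pathin_def dinterval_paths_def)
  moreover have "mono_on {0..1} b"
    using a ab by (simp add: dinterval_paths_def mono_on_def)
  ultimately show "b \<in> dinterval_paths"
    by (simp add: dinterval_paths_def pathin_def)
next
  fix x :: real assume "x \<in> topspace (top_of_set {0..1})"
  then show "(\<lambda>t. x) \<in> dinterval_paths"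
    by (simp add: dinterval_paths_def mono_on_def)
qed (simp add: dinterval_paths_def pathin_def)

definition dinterval :: "real dspace" where
  "dinterval = mk_dspace (top_of_set {0..1}) dinterval_paths"

lemma dtop_dinterval [simp]: "dtop dinterval = top_of_set {0..1}"
  and dpaths_dinterval [simp]: "dpaths dinterval = dinterval_paths"
  by (simp_all add: dinterval_def mk_dspace is_dspace_dinterval)

lemma pathin_prod: "pathin (prod_topology S T) c \<longleftrightarrow> pathin S (fst \<circ> c) \<and> pathin T (snd \<circ> c)"
  by (simp add: pathin_def continuous_map_pairwise)

lemma dconcat_o: "f \<circ> dconcat a b = dconcat (f \<circ> a) (f \<circ> b)"
  by (auto simp: dconcat_def)

lemma is_dspace_dprod:
  "is_dspace (prod_topology (dtop X) (dtop Y)) {c. fst \<circ> c \<in> dpaths X \<and> snd \<circ> c \<in> dpaths Y}"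
proof (rule is_dspaceI)
  fix a h assume "a \<in> {c. fst \<circ> c \<in> dpaths X \<and> snd \<circ> c \<in> dpaths Y}" "h \<in> dinterval_paths"
  then show "a \<circ> h \<in> {c. fst \<circ> c \<in> dpaths X \<and> snd \<circ> c \<in> dpaths Y}"
    using dpath_reparam[of "fst \<circ> a" X h] dpath_reparam[of "snd \<circ> a" Y h] by (simp add: comp_assoc)
next
  fix a b assume "a \<in> {c. fst \<circ> c \<in> dpaths X \<and> snd \<circ> c \<in> dpaths Y}"
    "\<And>t::real. 0 \<le> t \<Longrightarrow> t \<le> 1 \<Longrightarrow> b t = a t"
  then show "b \<in> {c. fst \<circ> c \<in> dpaths X \<and> snd \<circ> c \<in> dpaths Y}"
    using dpath_cong[of "fst \<circ> a" X "fst \<circ> b"] dpath_cong[of "snd \<circ> a" Y "snd \<circ> b"] by simp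
next
  fix x assume "x \<in> topspace (prod_topology (dtop X) (dtop Y))"
  then show "(\<lambda>t. x) \<in> {c. fst \<circ> c \<in> dpaths X \<and> snd \<circ> c \<in> dpaths Y}"
    using dpath_const[of "fst x" X] dpath_const[of "snd x" Y] by (auto simp: o_def)
next
  fix a b assume "a \<in> {c. fst \<circ> c \<in> dpaths X \<and> snd \<circ> c \<in> dpaths Y}"
    "b \<in> {c. fst \<circ> c \<in> dpaths X \<and> snd \<circ> c \<in> dpaths Y}" "a 1 = b 0"
  then show "dconcat a b \<in> {c. fst \<circ> c \<in> dpaths X \<and> snd \<circ> c \<in> dpaths Y}"
    by (simp add: dconcat_o dpath_concat)
qed (simp add: pathin_prod dpath_pathin)

definition dprod :: "'a dspace \<Rightarrow> 'b dspace \<Rightarrow> ('a \<times> 'b) dspace" where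
  "dprod X Y = mk_dspace (prod_topology (dtop X) (dtop Y))
                         {c. fst \<circ> c \<in> dpaths X \<and> snd \<circ> c \<in> dpaths Y}"

lemma dtop_dprod [simp]: "dtop (dprod X Y) = prod_topology (dtop X) (dtop Y)"
  and dpaths_dprod: "dpaths (dprod X Y) = {c. fst \<circ> c \<in> dpaths X \<and> snd \<circ> c \<in> dpaths Y}"
  by (simp_all add: dprod_def mk_dspace is_dspace_dprod)


section \<open>d-maps and d-homotopies\<close>

text \<open>A d-map matters only through its values on \<^term>\<open>dpoints X\<close>; accordingly all
  equations between d-maps below are required on points of the domain only.\<close>

definition dmap :: "'a dspace \<Rightarrow> 'b dspace \<Rightarrow> ('a \<Rightarrow> 'b) \<Rightarrow> bool" where
  "dmap X Y f \<longleftrightarrow> continuous_map (dtop X) (dtop Y) f \<and> (\<forall>a\<in>dpaths X. f \<circ> a \<in> dpaths Y)"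

definition dface :: "real \<Rightarrow> 'a \<Rightarrow> 'a \<times> real" where
  "dface \<alpha> x = (x, \<alpha>)"

definition dhomotopy ::
    "'a dspace \<Rightarrow> 'b dspace \<Rightarrow> ('a \<times> real \<Rightarrow> 'b) \<Rightarrow> ('a \<Rightarrow> 'b) \<Rightarrow> ('a \<Rightarrow> 'b) \<Rightarrow> bool" where
  "dhomotopy X Y \<phi> f g \<longleftrightarrow>
     dmap (dprod X dinterval) Y \<phi> \<and>
     (\<forall>x\<in>dpoints X. (\<phi> \<circ> dface 0) x = f x \<and> (\<phi> \<circ> dface 1) x = g x)"

definition dhomotopic :: "'a dspace \<Rightarrow> 'b dspace \<Rightarrow> ('a \<Rightarrow> 'b) \<Rightarrow> ('a \<Rightarrow> 'b) \<Rightarrow> bool" where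
  "dhomotopic X Y f g \<longleftrightarrow>
     dmap X Y f \<and> dmap X Y g \<and>
     equivclp (\<lambda>u v. dmap X Y u \<and> dmap X Y v \<and> (\<exists>\<phi>. dhomotopy X Y \<phi> u v)) f g"

definition vdhomotopic ::
    "'x dspace \<Rightarrow> 'e dspace \<Rightarrow> ('e \<Rightarrow> 'b) \<Rightarrow> ('x \<Rightarrow> 'e) \<Rightarrow> ('x \<Rightarrow> 'e) \<Rightarrow> bool" where
  "vdhomotopic X E p f g \<longleftrightarrow>
     (\<exists>(n::nat) F. F 0 = f \<and> F n = g \<and>
        (\<forall>k\<le>n. dmap X E (F k) \<and> (\<forall>x\<in>dpoints X. p (F k x) = p (f x))) \<and>
        (\<forall>k<n. \<exists>\<phi>. (dhomotopy X E \<phi> (F k) (F (Suc k)) \<or> dhomotopy X E \<phi> (F (Suc k)) (F k)) \<and>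
                    (\<forall>x\<in>dpoints X. \<forall>t\<in>{0..1}. p (\<phi> (x, t)) = p (f x))))"


section \<open>Directed weak fibrations\<close>

definition weak_dlifting :: "'x dspace \<Rightarrow> 'e dspace \<Rightarrow> 'b dspace \<Rightarrow> ('e \<Rightarrow> 'b) \<Rightarrow> bool" where
  "weak_dlifting X E B p \<longleftrightarrow>
     (\<forall>f' \<phi>. \<forall>\<alpha>\<in>{0,1}.
        dmap X E f' \<longrightarrow> dmap (dprod X dinterval) B \<phi> \<longrightarrow>
        (\<forall>x\<in>dpoints X. (\<phi> \<circ> dface \<alpha>) x = (p \<circ> f') x) \<longrightarrow>
        (\<exists>\<phi>'. dmap (dprod X dinterval) E \<phi>' \<and>
              (\<forall>z\<in>dpoints (dprod X dinterval). p (\<phi>' z) = \<phi> z) \<and>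
              vdhomotopic X E p (\<phi>' \<circ> dface \<alpha>) f'))"

text \<open>
  Definitions in HOL cannot quantify over types, so the test d-spaces \<open>X\<close> range over all d-spaces whose points
  are taken from the type \<^typ>\<open>'e \<times> (real \<Rightarrow> 'b)\<close>.  This is no restriction: the type is large
  enough to carry the universal test problem, namely the d-space of pairs \<open>(e, \<beta>)\<close> with
  \<open>\<beta>\<close> a d-path in \<open>B\<close> and \<open>\<beta> \<alpha> = p e\<close>.  Theorem \<open>directed_weak_fibration_lifting\<close> at the end
  of this theory proves the lifting property for test d-spaces over an arbitrary type.
\<close>

definition directed_weak_fibration :: "'e dspace \<Rightarrow> 'b dspace \<Rightarrow> ('e \<Rightarrow> 'b) \<Rightarrow> bool" where
  "directed_weak_fibration E B p \<longleftrightarrow>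
     dmap E B p \<and> (\<forall>X :: ('e \<times> (real \<Rightarrow> 'b)) dspace. weak_dlifting X E B p)"


section \<open>Directed homotopy equivalences\<close>

definition directed_homotopy_equivalence :: "'e dspace \<Rightarrow> 'f dspace \<Rightarrow> ('e \<Rightarrow> 'f) \<Rightarrow> bool" where
  "directed_homotopy_equivalence E E' f \<longleftrightarrow>
     dmap E E' f \<and>
     (\<exists>f'. dmap E' E f' \<and> dhomotopic E E (f' \<circ> f) id \<and> dhomotopic E' E' (f \<circ> f') id)"

definition directed_fibre_homotopy_equivalence ::
    "'e dspace \<Rightarrow> 'f dspace \<Rightarrow> ('e \<Rightarrow> 'b) \<Rightarrow> ('f \<Rightarrow> 'b) \<Rightarrow> ('e \<Rightarrow> 'f) \<Rightarrow> bool" where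
  "directed_fibre_homotopy_equivalence E E' p p' f \<longleftrightarrow>
     dmap E E' f \<and> (\<forall>x\<in>dpoints E. p' (f x) = p x) \<and>
     (\<exists>g. dmap E' E g \<and> (\<forall>y\<in>dpoints E'. p (g y) = p' y) \<and>
          vdhomotopic E E p (g \<circ> f) id \<and> vdhomotopic E' E' p' (f \<circ> g) id)"


section \<open>Independence of the test type\<close>

lemma dmapD:
  assumes "dmap X Y f"
  shows dmap_cont: "continuous_map (dtop X) (dtop Y) f"
    and dmap_path: "a \<in> dpaths X \<Longrightarrow> (\<lambda>t. f (a t)) \<in> dpaths Y"
    and dmap_in: "x \<in> dpoints X \<Longrightarrow> f x \<in> dpoints Y"
  using assms by (auto simp: dmap_def o_def continuous_map_def)

lemma dmapI:
  assumes "continuous_map (dtop X) (dtop Y) f" "\<And>a. a \<in> dpaths X \<Longrightarrow> (\<lambda>t. f (a t)) \<in> dpaths Y"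
  shows "dmap X Y f"
  using assms by (auto simp: dmap_def o_def)

lemma dmap_compose: "dmap X Y f \<Longrightarrow> dmap Y Z g \<Longrightarrow> dmap X Z (g \<circ> f)"
  by (auto simp: dmap_def comp_assoc intro: continuous_map_compose)

lemma dmap_times_id:
  assumes "dmap X Y k"
  shows "dmap (dprod X dinterval) (dprod Y dinterval) (\<lambda>(x,t). (k x, t))"
proof (rule dmapI)
  show "continuous_map (dtop (dprod X dinterval)) (dtop (dprod Y dinterval)) (\<lambda>(x,t). (k x, t))"
    using dmap_cont[OF assms] continuous_map_prod_top[of "dtop X" "dtop dinterval" "dtop Y" "dtop dinterval" k id]
    by (simp add: id_def)
next
  fix a assume "a \<in> dpaths (dprod X dinterval)"
  then show "(\<lambda>t. case a t of (x, t) \<Rightarrow> (k x, t)) \<in> dpaths (dprod Y dinterval)"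
    using dmap_path[OF assms, of "fst \<circ> a"] by (simp add: dpaths_dprod o_def case_prod_unfold)
qed

text \<open>A path is directed if it is so before and after some parameter value.\<close>

lemma dpath_split:
  assumes "0 \<le> c" "c \<le> 1"
    and 1: "(\<lambda>s. g (c * s)) \<in> dpaths X"
    and 2: "(\<lambda>s. g (c + (1 - c) * s)) \<in> dpaths X"
  shows "g \<in> dpaths X"
proof -
  consider "c = 0" | "c = 1" | "0 < c" "c < 1" using assms by linarith
  then show ?thesis
  proof cases
    case 3
    define h where "h t = (if t \<le> c then t / (2 * c) else 1/2 + (t - c) / (2 * (1 - c)))" for t
    have "h \<in> dinterval_paths"
      unfolding dinterval_paths_iff
    proof (intro conjI)
      show "continuous_on {0..1} h"
        unfolding h_def by (rule continuous_on_dconcat_aux) (use 3 in \<open>auto intro!: continuous_intros\<close>)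
      show m: "mono_on {0..1} h"
      proof (rule mono_onI)
        fix r s :: real assume rs: "r \<in> {0..1}" "s \<in> {0..1}" "r \<le> s"
        consider "s \<le> c" | "r \<le> c" "c < s" | "c < r" by linarith
        then show "h r \<le> h s"
        proof cases
          case 2
          then have "h r \<le> 1/2" "1/2 \<le> h s" using 3 by (auto simp: h_def field_simps)
          then show ?thesis by linarith
        qed (use rs 3 in \<open>auto simp: h_def divide_right_mono\<close>)
      qed
      have "h 0 = 0" "h 1 = 1" using 3 by (auto simp: h_def field_simps)
      then have "0 \<le> h t \<and> h t \<le> 1" if "t \<in> {0..1}" for t
        using mono_onD[OF m, of 0 t] mono_onD[OF m, of t 1] that by simp
      then show "h ` {0..1} \<subseteq> {0..1}" by auto
    qed
    moreover have "dconcat (\<lambda>s. g (c * s)) (\<lambda>s. g (c + (1 - c) * s)) \<in> dpaths X"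
      using 1 2 by (rule dpath_concat) simp
    ultimately have "dconcat (\<lambda>s. g (c * s)) (\<lambda>s. g (c + (1 - c) * s)) \<circ> h \<in> dpaths X"
      by (rule dpath_reparam[rotated])
    then show ?thesis
    proof (rule dpath_cong)
      fix t :: real assume t: "0 \<le> t" "t \<le> 1"
      show "g t = (dconcat (\<lambda>s. g (c * s)) (\<lambda>s. g (c + (1 - c) * s)) \<circ> h) t"
      proof (cases "t \<le> c")
        case True
        then have "h t \<le> 1/2" "c * (2 * h t) = t" using 3 by (auto simp: h_def field_simps)
        then show ?thesis by (simp add: dconcat_def)
      next
        case False
        then have "h t > 1/2" using 3 by (auto simp: h_def)
        moreover have "(1 - c) * (2 * h t - 1) = t - c"
          using 3 False by (simp add: h_def divide_simps) (simp add: algebra_simps)?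
        ultimately show ?thesis by (simp add: dconcat_def)
      qed
    qed
  qed (use 1 2 in simp_all)
qed

text \<open>The compact-open topology.  Functions agreeing on \<open>{0..1}\<close> are not identified, which is harmless here.\<close>

definition cotop :: "(real \<Rightarrow> 'b) set \<Rightarrow> 'b topology \<Rightarrow> (real \<Rightarrow> 'b) topology" where
  "cotop P T = subtopology
     (topology_generated_by {{\<beta> :: real \<Rightarrow> _. \<beta> ` K \<subseteq> U} | K U. compact K \<and> K \<subseteq> {0..1} \<and> openin T U}) P"

lemma topspace_cotop [simp]: "topspace (cotop P T) = P"
proof -
  have "\<Union>{{\<beta> :: real \<Rightarrow> _. \<beta> ` K \<subseteq> U} | K U. compact K \<and> K \<subseteq> {0..1} \<and> openin T U} = UNIV"
    by (rule UNIV_eq_I[symmetric], rule UnionI[of UNIV]) (auto intro!: exI[of _ "{}"])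
  then show ?thesis by (simp add: cotop_def)
qed

lemma continuous_map_into_cotop:
  assumes c: "continuous_map (prod_topology S (top_of_set {0..1})) T (\<lambda>(x,t). k x t)"
    and P: "k \<in> topspace S \<rightarrow> P"
  shows "continuous_map S (cotop P T) k"
  unfolding cotop_def continuous_map_in_subtopology
proof (intro conjI continuous_on_generated_topo)
  fix W assume "W \<in> {{\<beta> :: real \<Rightarrow> _. \<beta> ` K \<subseteq> U} | K U. compact K \<and> K \<subseteq> {0..1} \<and> openin T U}"
  then obtain K U where W: "W = {\<beta>. \<beta> ` K \<subseteq> U}" and K: "compact K" "K \<subseteq> {0..1}" and U: "openin T U"
    by blast
  let ?O = "{z \<in> topspace S \<times> {0..1}. (case z of (x,t) \<Rightarrow> k x t) \<in> U}"
  have opn: "openin (prod_topology S (top_of_set {0..1})) ?O"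
    using openin_continuous_map_preimage[OF c U] by simp
  show "openin S (k -` W \<inter> topspace S)"
  proof (subst openin_subopen, intro ballI)
    fix x assume x: "x \<in> k -` W \<inter> topspace S"
    have "compactin S {x}" "compactin (top_of_set {0..1}) K"
      using x K by (auto simp: compactin_subtopology)
    moreover have "{x} \<times> K \<subseteq> ?O" using x K by (auto simp: W)
    ultimately obtain A V where AV: "openin S A" "{x} \<subseteq> A" "K \<subseteq> V" "A \<times> V \<subseteq> ?O"
      by (rule Wallace_theorem_prod_topology[OF _ _ opn])
    have "k y t \<in> U" if "y \<in> A" "t \<in> K" for y t
      using subsetD[OF AV(4), of "(y, t)"] subsetD[OF AV(3)] that by simp
    then have "A \<subseteq> k -` W \<inter> topspace S"
      using openin_subset[OF AV(1)] by (simp add: W subset_eq image_subset_iff)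
    then show "\<exists>A. openin S A \<and> x \<in> A \<and> A \<subseteq> k -` W \<inter> topspace S"
      using AV(1,2) by (intro exI[of _ A]) simp
  qed
next
  show "k ` topspace S \<subseteq> \<Union>{{\<beta> :: real \<Rightarrow> _. \<beta> ` K \<subseteq> U} | K U. compact K \<and> K \<subseteq> {0..1} \<and> openin T U}"
    by (rule subset_trans[OF subset_UNIV Union_upper]) (auto intro!: exI[of _ "{}"])
qed (use P in auto)

lemma continuous_map_eval:
  assumes P: "\<And>\<beta>. \<beta> \<in> P \<Longrightarrow> pathin T \<beta>"
  shows "continuous_map (prod_topology (cotop P T) (top_of_set {0..1})) T (\<lambda>(\<beta>,t). \<beta> t)"
  unfolding continuous_map_def
proof (intro conjI allI impI)
  show "(\<lambda>(\<beta>,t). \<beta> t) \<in> topspace (prod_topology (cotop P T) (top_of_set {0..1})) \<rightarrow> topspace T"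
    using P by (auto simp: pathin_def continuous_map_def)
next
  fix U assume U: "openin T U"
  let ?O = "{z \<in> topspace (prod_topology (cotop P T) (top_of_set {0..1})). (case z of (\<beta>,t) \<Rightarrow> \<beta> t) \<in> U}"
  show "openin (prod_topology (cotop P T) (top_of_set {0..1})) ?O"
    unfolding openin_prod_topology_alt
  proof (intro allI impI)
    fix \<beta> t assume "(\<beta>, t) \<in> ?O"
    then have b: "\<beta> \<in> P" and t: "t \<in> {0..1}" and bt: "\<beta> t \<in> U" by auto
    have "openin (top_of_set {0..1}) {s \<in> {0..1}. \<beta> s \<in> U}"
      using openin_continuous_map_preimage[OF P[OF b, unfolded pathin_def] U] by simp
    then have "\<forall>x\<in>{s \<in> {0..1}. \<beta> s \<in> U}. \<exists>e>0. \<forall>x'\<in>{0..1}. dist x' x < e \<longrightarrow> x' \<in> {s \<in> {0..1}. \<beta> s \<in> U}"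
      unfolding openin_euclidean_subtopology_iff by (rule conjunct2)
    from bspec[OF this, of t] obtain e where e: "e > 0" "\<And>s. s \<in> {0..1} \<Longrightarrow> dist s t < e \<Longrightarrow> \<beta> s \<in> U"
      using t bt by auto
    define K where "K = {0..1} \<inter> cball t (e/2)"
    have K: "compact K" "K \<subseteq> {0..1}" by (auto simp: K_def intro: compact_Int)
    have "openin (cotop P T) ({\<beta>. \<beta> ` K \<subseteq> U} \<inter> P)"
      unfolding cotop_def openin_subtopology using K U
      by (intro exI[of _ "{\<beta>. \<beta> ` K \<subseteq> U}"] conjI topology_generated_by_Basis) auto
    moreover have "openin (top_of_set {0..1}) ({0..1} \<inter> ball t (e/2))"
      by (simp add: openin_open_Int)
    moreover have "\<beta> ` K \<subseteq> U"
    proof clarify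
      fix s assume "s \<in> K"
      then show "\<beta> s \<in> U" using e by (intro e(2)) (simp_all add: K_def dist_commute)
    qed
    moreover have "({\<beta>. \<beta> ` K \<subseteq> U} \<inter> P) \<times> ({0..1} \<inter> ball t (e/2)) \<subseteq> ?O"
    proof clarsimp
      fix \<gamma> s assume "\<gamma> ` K \<subseteq> U" "0 \<le> s" "s \<le> 1" "dist t s * 2 < e"
      moreover from this have "s \<in> K" by (simp add: K_def)
      ultimately show "\<gamma> s \<in> U" by blast
    qed
    ultimately show "\<exists>A V. openin (cotop P T) A \<and> openin (top_of_set {0..1}) V \<and> \<beta> \<in> A \<and> t \<in> V \<and> A \<times> V \<subseteq> ?O"
      using b t e by (intro exI[of _ "{\<beta>. \<beta> ` K \<subseteq> U} \<inter> P"] exI[of _ "{0..1} \<inter> ball t (e/2)"] conjI) simp_all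
  qed
qed

text \<open>The universal test d-space: a path in it is directed iff its first component is and the
  adjoint of its second component, a map on the square, preserves d-paths.\<close>

definition dtest_topology ::
    "'e dspace \<Rightarrow> 'b dspace \<Rightarrow> ('e \<Rightarrow> 'b) \<Rightarrow> real \<Rightarrow> ('e \<times> (real \<Rightarrow> 'b)) topology" where
  "dtest_topology E B p \<alpha> =
     subtopology (prod_topology (dtop E) (cotop (dpaths B) (dtop B))) {(e, \<beta>). \<beta> \<alpha> = p e}"

definition dtest_paths ::
    "'e dspace \<Rightarrow> 'b dspace \<Rightarrow> ('e \<Rightarrow> 'b) \<Rightarrow> real \<Rightarrow> (real \<Rightarrow> 'e \<times> (real \<Rightarrow> 'b)) set" where
  "dtest_paths E B p \<alpha> =
     {c. pathin (dtest_topology E B p \<alpha>) c \<and> fst \<circ> c \<in> dpaths E \<and>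
         (\<forall>a\<in>dinterval_paths. \<forall>b\<in>dinterval_paths. (\<lambda>t. snd (c (a t)) (b t)) \<in> dpaths B)}"

lemma topspace_dtest:
  "topspace (dtest_topology E B p \<alpha>) = {(e, \<beta>). e \<in> dpoints E \<and> \<beta> \<in> dpaths B \<and> \<beta> \<alpha> = p e}"
  by (auto simp: dtest_topology_def)

lemma dinterval_paths_compose:
  "h \<in> dinterval_paths \<Longrightarrow> k \<in> dinterval_paths \<Longrightarrow> (\<lambda>t. h (k t)) \<in> dinterval_paths"
  using dpath_reparam'[of h dinterval k] by simp

lemma dinterval_path_affine:
  assumes "0 \<le> c" "0 \<le> d" "c + d \<le> 1"
  shows "(\<lambda>t. c + d * t) \<in> dinterval_paths"
  unfolding dinterval_paths_iff
proof (intro conjI)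
  show "(\<lambda>t. c + d * t) ` {0..1} \<subseteq> {0..1}"
  proof clarify
    fix t :: real assume "t \<in> {0..1}"
    then have "0 \<le> d * t" "d * t \<le> d" using assms by (auto simp: mult_left_le)
    then show "c + d * t \<in> {0..1}" using assms by simp
  qed
  show "mono_on {0..1} (\<lambda>t. c + d * t)"
    using assms by (intro mono_onI) (simp add: mult_left_mono)
qed (intro continuous_intros)

lemma dconcat_adjoint:
  assumes u: "\<And>a b. a \<in> dinterval_paths \<Longrightarrow> b \<in> dinterval_paths \<Longrightarrow> (\<lambda>t. u (a t) (b t)) \<in> dpaths B"
    and v: "\<And>a b. a \<in> dinterval_paths \<Longrightarrow> b \<in> dinterval_paths \<Longrightarrow> (\<lambda>t. v (a t) (b t)) \<in> dpaths B"
    and uv: "u 1 = v 0"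
    and a: "a \<in> dinterval_paths" and b: "b \<in> dinterval_paths"
  shows "(\<lambda>t. dconcat u v (a t) (b t)) \<in> dpaths B"
proof -
  have am: "a x \<le> a y" if "a \<in> dinterval_paths" "0 \<le> x" "x \<le> y" "y \<le> 1" for x y :: real and a
    using that by (auto simp: dinterval_paths_iff mono_on_def)
  have low: "(\<lambda>t. dconcat u v (a t) (b t)) \<in> dpaths B"
    if a: "a \<in> dinterval_paths" and b: "b \<in> dinterval_paths" and a1: "a 1 \<le> 1/2" for a b
  proof (rule dpath_cong)
    have "(\<lambda>t. 2 * a t) \<in> dinterval_paths"
      unfolding dinterval_paths_iff
    proof (intro conjI)
      show "(\<lambda>t. 2 * a t) ` {0..1} \<subseteq> {0..1}"
      proof clarify
        fix t :: real assume "t \<in> {0..1}"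
        then show "2 * a t \<in> {0..1}"
          using am[OF a, of t 1] a1 dinterval_path_bounds[OF a, of t] by auto
      qed
      show "mono_on {0..1} (\<lambda>t. 2 * a t)"
        using a by (auto simp: dinterval_paths_iff mono_on_def)
      show "continuous_on {0..1} (\<lambda>t. 2 * a t)"
        using a unfolding dinterval_paths_iff by (intro continuous_on_mult_left) blast
    qed
    then show "(\<lambda>t. u (2 * a t) (b t)) \<in> dpaths B" using u b by blast
    show "dconcat u v (a t) (b t) = u (2 * a t) (b t)" if "0 \<le> t" "t \<le> 1" for t
      using am[OF a that(1,2) order_refl] a1 by (simp add: dconcat_def)
  qed
  have high: "(\<lambda>t. dconcat u v (a t) (b t)) \<in> dpaths B"
    if a: "a \<in> dinterval_paths" and b: "b \<in> dinterval_paths" and a0: "1/2 \<le> a 0" for a b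
  proof (rule dpath_cong)
    have "(\<lambda>t. 2 * a t - 1) \<in> dinterval_paths"
      unfolding dinterval_paths_iff
    proof (intro conjI)
      show "(\<lambda>t. 2 * a t - 1) ` {0..1} \<subseteq> {0..1}"
      proof clarify
        fix t :: real assume "t \<in> {0..1}"
        then show "2 * a t - 1 \<in> {0..1}"
          using am[OF a, of 0 t] a0 dinterval_path_bounds[OF a, of t] by auto
      qed
      show "mono_on {0..1} (\<lambda>t. 2 * a t - 1)"
        using a by (auto simp: dinterval_paths_iff mono_on_def)
      show "continuous_on {0..1} (\<lambda>t. 2 * a t - 1)"
        using a unfolding dinterval_paths_iff
        by (intro continuous_on_diff continuous_on_mult_left continuous_on_const) blast
    qed
    then show "(\<lambda>t. v (2 * a t - 1) (b t)) \<in> dpaths B" using v b by blast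
    show "dconcat u v (a t) (b t) = v (2 * a t - 1) (b t)" if "0 \<le> t" "t \<le> 1" for t
    proof (cases "a t = 1/2")
      case True
      show ?thesis unfolding dconcat_def True using uv by simp
    next
      case False
      then show ?thesis
        using am[OF a order_refl that] a0 by (simp add: dconcat_def)
    qed
  qed
  consider "a 1 \<le> 1/2" | "1/2 \<le> a 0" | "a 0 \<le> 1/2" "1/2 \<le> a 1" by linarith
  then show ?thesis
  proof cases
    case 3
    have "\<exists>m\<ge>0. m \<le> 1 \<and> a m = 1/2"
      using 3 a unfolding dinterval_paths_iff by (intro IVT') auto
    then obtain m where m: "0 \<le> m" "m \<le> 1" "a m = 1/2" by blast
    have h1: "(\<lambda>s. m * s) \<in> dinterval_paths"
      using dinterval_path_affine[of 0 m] m by simp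
    have h2: "(\<lambda>s. m + (1 - m) * s) \<in> dinterval_paths"
      using dinterval_path_affine[of m "1 - m"] m by simp
    show ?thesis
    proof (rule dpath_split[OF m(1,2)])
      show "(\<lambda>s. dconcat u v (a (m * s)) (b (m * s))) \<in> dpaths B"
        by (rule low[OF dinterval_paths_compose[OF a h1] dinterval_paths_compose[OF b h1]])
           (simp add: m)
      show "(\<lambda>s. dconcat u v (a (m + (1 - m) * s)) (b (m + (1 - m) * s))) \<in> dpaths B"
        by (rule high[OF dinterval_paths_compose[OF a h2] dinterval_paths_compose[OF b h2]])
           (simp add: m)
    qed
  qed (use low high a b in blast)+
qed

lemma is_dspace_dtest: "is_dspace (dtest_topology E B p \<alpha>) (dtest_paths E B p \<alpha>)"
proof (rule is_dspaceI)
  fix x assume x: "x \<in> topspace (dtest_topology E B p \<alpha>)"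
  then have "fst x \<in> dpoints E" "snd x \<in> dpaths B" by (auto simp: topspace_dtest)
  then show "(\<lambda>t. x) \<in> dtest_paths E B p \<alpha>"
    using x by (simp add: dtest_paths_def dpath_const dpath_reparam' o_def)
next
  fix c h assume c: "c \<in> dtest_paths E B p \<alpha>" and h: "h \<in> dinterval_paths"
  have "pathin (dtest_topology E B p \<alpha>) (c \<circ> h)"
    unfolding pathin_def using c h
    by (intro continuous_map_compose[of _ "top_of_set {0..1}"])
       (simp_all add: dtest_paths_def dinterval_paths_def pathin_def)
  then show "c \<circ> h \<in> dtest_paths E B p \<alpha>"
    using c h dpath_reparam[of "fst \<circ> c" E h]
    by (auto simp: dtest_paths_def comp_assoc intro: dinterval_paths_compose)
next
  fix c d assume c: "c \<in> dtest_paths E B p \<alpha>" and d: "d \<in> dtest_paths E B p \<alpha>" and eq: "c 1 = d 0"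
  have "pathin (dtest_topology E B p \<alpha>) (dconcat c d)"
    using c d eq by (intro pathin_dconcat) (simp_all add: dtest_paths_def)
  moreover have "fst \<circ> dconcat c d \<in> dpaths E"
    using c d eq by (simp add: dconcat_o dpath_concat dtest_paths_def)
  moreover have "(\<lambda>t. snd (dconcat c d (a t)) (b t)) \<in> dpaths B"
    if "a \<in> dinterval_paths" "b \<in> dinterval_paths" for a b
  proof -
    have "(\<lambda>t. dconcat (snd \<circ> c) (snd \<circ> d) (a t) (b t)) \<in> dpaths B"
      by (rule dconcat_adjoint[OF _ _ _ that]) (use c d eq in \<open>auto simp: dtest_paths_def\<close>)
    then show ?thesis by (simp flip: dconcat_o)
  qed
  ultimately show "dconcat c d \<in> dtest_paths E B p \<alpha>"
    by (simp add: dtest_paths_def)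
next
  fix c d assume c: "c \<in> dtest_paths E B p \<alpha>" and eq: "\<And>t. 0 \<le> t \<Longrightarrow> t \<le> 1 \<Longrightarrow> d t = c t"
  have "pathin (dtest_topology E B p \<alpha>) c" "fst \<circ> c \<in> dpaths E"
    using c by (simp_all add: dtest_paths_def)
  then have "pathin (dtest_topology E B p \<alpha>) d" "fst \<circ> d \<in> dpaths E"
    by (auto intro: pathin_cong[OF _ eq] dpath_cong simp: eq)
  moreover have "(\<lambda>t. snd (d (a t)) (b t)) \<in> dpaths B"
    if a: "a \<in> dinterval_paths" and b: "b \<in> dinterval_paths" for a b
  proof (rule dpath_cong)
    show "(\<lambda>t. snd (c (a t)) (b t)) \<in> dpaths B"
      using c a b by (simp add: dtest_paths_def)
    show "snd (d (a t)) (b t) = snd (c (a t)) (b t)" if "0 \<le> t" "t \<le> 1" for t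
      using eq[OF dinterval_path_bounds[OF a that]] by simp
  qed
  ultimately show "d \<in> dtest_paths E B p \<alpha>"
    by (simp add: dtest_paths_def)
qed (simp add: dtest_paths_def)

definition dtest :: "'e dspace \<Rightarrow> 'b dspace \<Rightarrow> ('e \<Rightarrow> 'b) \<Rightarrow> real \<Rightarrow> ('e \<times> (real \<Rightarrow> 'b)) dspace" where
  "dtest E B p \<alpha> = mk_dspace (dtest_topology E B p \<alpha>) (dtest_paths E B p \<alpha>)"

lemma dtop_dtest: "dtop (dtest E B p \<alpha>) = dtest_topology E B p \<alpha>"
  and dpaths_dtest: "dpaths (dtest E B p \<alpha>) = dtest_paths E B p \<alpha>"
  by (simp_all add: dtest_def mk_dspace is_dspace_dtest)

lemma dmap_dtest_fst: "dmap (dtest E B p \<alpha>) E fst"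
proof (rule dmapI)
  show "continuous_map (dtop (dtest E B p \<alpha>)) (dtop E) fst"
    unfolding dtop_dtest dtest_topology_def
    by (intro continuous_map_from_subtopology continuous_map_fst)
  show "(\<lambda>t. fst (a t)) \<in> dpaths E" if "a \<in> dpaths (dtest E B p \<alpha>)" for a
    using that by (simp add: dpaths_dtest dtest_paths_def o_def)
qed

lemma dmap_dtest_eval: "dmap (dprod (dtest E B p \<alpha>) dinterval) B (\<lambda>(z, t). snd z t)"
proof (rule dmapI)
  have "continuous_map (prod_topology (dtest_topology E B p \<alpha>) (top_of_set {0..1}))
          (prod_topology (cotop (dpaths B) (dtop B)) (top_of_set {0..1})) (\<lambda>(z, t). (snd z, id t))"
    unfolding dtest_topology_def continuous_map_prod_top
    by (intro disjI2 conjI continuous_map_from_subtopology continuous_map_snd continuous_map_id)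
  from continuous_map_compose[OF this continuous_map_eval[OF dpath_pathin]]
  show "continuous_map (dtop (dprod (dtest E B p \<alpha>) dinterval)) (dtop B) (\<lambda>(z, t). snd z t)"
    by (simp add: dtop_dtest o_def case_prod_unfold)
next
  fix c assume "c \<in> dpaths (dprod (dtest E B p \<alpha>) dinterval)"
  then have "fst \<circ> c \<in> dtest_paths E B p \<alpha>" and s: "snd \<circ> c \<in> dinterval_paths"
    by (simp_all add: dpaths_dprod dpaths_dtest)
  then have *: "\<forall>a\<in>dinterval_paths. \<forall>b\<in>dinterval_paths. (\<lambda>t. snd ((fst \<circ> c) (a t)) (b t)) \<in> dpaths B"
    by (simp add: dtest_paths_def)
  have "(\<lambda>t. t) \<in> dinterval_paths"
    using dinterval_path_affine[of 0 1] by simp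
  from bspec[OF bspec[OF * this] s] show "(\<lambda>t. case c t of (z, t) \<Rightarrow> snd z t) \<in> dpaths B"
    by (simp add: case_prod_unfold)
qed

lemma dmap_into_dtest:
  assumes f: "dmap X E f" and \<phi>: "dmap (dprod X dinterval) B \<phi>"
    and eq: "\<And>x. x \<in> dpoints X \<Longrightarrow> \<phi> (x, \<alpha>) = p (f x)"
  shows "dmap X (dtest E B p \<alpha>) (\<lambda>x. (f x, \<lambda>t. \<phi> (x, t)))"
proof (rule dmapI)
  have slice: "(\<lambda>t. \<phi> (x, t)) \<in> dpaths B" if "x \<in> dpoints X" for x
  proof -
    have "(\<lambda>t. t) \<in> dinterval_paths"
      using dinterval_path_affine[of 0 1] by simp
    then have "(\<lambda>t. (x, t)) \<in> dpaths (dprod X dinterval)"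
      using that by (simp add: dpaths_dprod o_def dpath_const)
    from dmap_path[OF \<phi> this] show ?thesis .
  qed
  have "continuous_map (dtop X) (cotop (dpaths B) (dtop B)) (\<lambda>x t. \<phi> (x, t))"
    by (rule continuous_map_into_cotop) (use dmap_cont[OF \<phi>] slice in auto)
  then show cont: "continuous_map (dtop X) (dtop (dtest E B p \<alpha>)) (\<lambda>x. (f x, \<lambda>t. \<phi> (x, t)))"
    unfolding dtop_dtest dtest_topology_def continuous_map_in_subtopology continuous_map_pairwise
    using dmap_cont[OF f] eq by (simp add: o_def image_subset_iff)
  fix a assume a: "a \<in> dpaths X"
  have "pathin (dtest_topology E B p \<alpha>) (\<lambda>t. (f (a t), \<lambda>s. \<phi> (a t, s)))"
    using pathin_compose[OF dpath_pathin[OF a] cont] by (simp add: dtop_dtest o_def)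
  moreover have "(\<lambda>t. \<phi> (a (h t), b t)) \<in> dpaths B"
    if "h \<in> dinterval_paths" "b \<in> dinterval_paths" for h b
  proof -
    have "(\<lambda>t. (a (h t), b t)) \<in> dpaths (dprod X dinterval)"
      using that a by (simp add: dpaths_dprod o_def dpath_reparam')
    from dmap_path[OF \<phi> this] show ?thesis .
  qed
  ultimately show "(\<lambda>t. (f (a t), \<lambda>s. \<phi> (a t, s))) \<in> dpaths (dtest E B p \<alpha>)"
    using dmap_path[OF f a] by (simp add: dpaths_dtest dtest_paths_def o_def)
qed

lemma dhomotopy_precompose:
  assumes k: "dmap X Y k" and \<phi>: "dhomotopy Y Z \<phi> f g"
  shows "dhomotopy X Z (\<phi> \<circ> (\<lambda>(x, t). (k x, t))) (f \<circ> k) (g \<circ> k)"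
  using \<phi> dmap_compose[OF dmap_times_id[OF k], of Z \<phi>] dmap_in[OF k]
  by (simp add: dhomotopy_def dface_def)

lemma vdhomotopic_precompose:
  assumes k: "dmap X Y k" and v: "vdhomotopic Y E p f g"
  shows "vdhomotopic X E p (f \<circ> k) (g \<circ> k)"
proof -
  obtain n :: nat and F where F: "F 0 = f" "F n = g"
    and F1: "\<And>i. i \<le> n \<Longrightarrow> dmap Y E (F i)" "\<And>i y. i \<le> n \<Longrightarrow> y \<in> dpoints Y \<Longrightarrow> p (F i y) = p (f y)"
    and F2: "\<And>i. i < n \<Longrightarrow>
        \<exists>\<phi>. (dhomotopy Y E \<phi> (F i) (F (Suc i)) \<or> dhomotopy Y E \<phi> (F (Suc i)) (F i)) \<and>
            (\<forall>y\<in>dpoints Y. \<forall>t\<in>{0..1}. p (\<phi> (y, t)) = p (f y))"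
    using v unfolding vdhomotopic_def by blast
  show ?thesis
    unfolding vdhomotopic_def
  proof (intro exI[of _ n] exI[of _ "\<lambda>i. F i \<circ> k"] conjI allI impI ballI)
    fix i assume "i < n"
    then obtain \<phi> where
      1: "dhomotopy Y E \<phi> (F i) (F (Suc i)) \<or> dhomotopy Y E \<phi> (F (Suc i)) (F i)" and
      2: "\<forall>y\<in>dpoints Y. \<forall>t\<in>{0..1}. p (\<phi> (y, t)) = p (f y)"
      using F2 by blast
    show "\<exists>\<phi>. (dhomotopy X E \<phi> (F i \<circ> k) (F (Suc i) \<circ> k) \<or> dhomotopy X E \<phi> (F (Suc i) \<circ> k) (F i \<circ> k)) \<and>
            (\<forall>x\<in>dpoints X. \<forall>t\<in>{0..1}. p (\<phi> (x, t)) = p ((f \<circ> k) x))"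
    proof (intro exI[of _ "\<phi> \<circ> (\<lambda>(x, t). (k x, t))"] conjI ballI)
      show "dhomotopy X E (\<phi> \<circ> (\<lambda>(x, t). (k x, t))) (F i \<circ> k) (F (Suc i) \<circ> k) \<or>
            dhomotopy X E (\<phi> \<circ> (\<lambda>(x, t). (k x, t))) (F (Suc i) \<circ> k) (F i \<circ> k)"
        using 1 by (blast intro: dhomotopy_precompose[OF k])
      show "p ((\<phi> \<circ> (\<lambda>(x, t). (k x, t))) (x, t)) = p ((f \<circ> k) x)" if "x \<in> dpoints X" "t \<in> {0..1}" for x t
        using 2 dmap_in[OF k that(1)] that(2) by simp
    qed
  next
    fix i assume i: "i \<le> n"
    show "dmap X E (F i \<circ> k)" by (rule dmap_compose[OF k F1(1)[OF i]])
    show "p ((F i \<circ> k) x) = p ((f \<circ> k) x)" if "x \<in> dpoints X" for x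
      using F1(2)[OF i dmap_in[OF k that]] by simp
  qed (use F in simp_all)
qed

theorem directed_weak_fibration_lifting:
  fixes X :: "'x dspace" and E :: "'e dspace" and B :: "'b dspace"
  assumes "directed_weak_fibration E B p"
  shows "weak_dlifting X E B p"
  unfolding weak_dlifting_def
proof (intro allI ballI impI)
  fix f' :: "'x \<Rightarrow> 'e" and \<phi> :: "'x \<times> real \<Rightarrow> 'b" and \<alpha> :: real
  assume \<alpha>: "\<alpha> \<in> {0, 1}" and f': "dmap X E f'" and \<phi>: "dmap (dprod X dinterval) B \<phi>"
    and eq: "\<forall>x\<in>dpoints X. (\<phi> \<circ> dface \<alpha>) x = (p \<circ> f') x"
  let ?U = "dtest E B p \<alpha>" and ?ev = "\<lambda>(z, t). snd z t :: 'b"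
  define k where "k x = (f' x, \<lambda>t. \<phi> (x, t))" for x
  have k: "dmap X ?U k"
    unfolding k_def using eq by (intro dmap_into_dtest[OF f' \<phi>]) (simp add: dface_def)
  have "weak_dlifting ?U E B p"
    using assms by (simp add: directed_weak_fibration_def)
  moreover have "\<forall>z\<in>dpoints ?U. (?ev \<circ> dface \<alpha>) z = (p \<circ> fst) z"
    by (auto simp: dtop_dtest topspace_dtest dface_def)
  ultimately obtain \<Phi> where \<Phi>: "dmap (dprod ?U dinterval) E \<Phi>"
      "\<forall>z\<in>dpoints (dprod ?U dinterval). p (\<Phi> z) = ?ev z"
    and v: "vdhomotopic ?U E p (\<Phi> \<circ> dface \<alpha>) fst"
    using \<alpha> dmap_dtest_fst dmap_dtest_eval unfolding weak_dlifting_def by metis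
  let ?\<phi>' = "\<Phi> \<circ> (\<lambda>(x, t). (k x, t))"
  have "p (?\<phi>' z) = \<phi> z" if z: "z \<in> dpoints (dprod X dinterval)" for z
  proof -
    obtain x t where [simp]: "z = (x, t)" by (cases z)
    have "(k x, t) \<in> dpoints (dprod ?U dinterval)"
      using z dmap_in[OF k] by auto
    from \<Phi>(2)[rule_format, OF this] show ?thesis by (simp add: k_def)
  qed
  moreover have "?\<phi>' \<circ> dface \<alpha> = (\<Phi> \<circ> dface \<alpha>) \<circ> k" "fst \<circ> k = f'"
    by (auto simp: fun_eq_iff dface_def k_def)
  then have "vdhomotopic X E p (?\<phi>' \<circ> dface \<alpha>) f'"
    using vdhomotopic_precompose[OF k v] by simp
  ultimately show "\<exists>\<phi>'. dmap (dprod X dinterval) E \<phi>' \<and>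
      (\<forall>z\<in>dpoints (dprod X dinterval). p (\<phi>' z) = \<phi> z) \<and> vdhomotopic X E p (\<phi>' \<circ> dface \<alpha>) f'"
    using dmap_compose[OF dmap_times_id[OF k] \<Phi>(1)] by blast
qed

end

theory Submission
  imports Defs
begin

text \<open>
  Lifts of a homotopy in the base are determined, up to vertical homotopy, by their restriction to
  either end.  Let \<open>f \<circ> g = w\<^sub>0, w\<^sub>1, \<dots>, w\<^sub>n = id\<close> be a zigzag of d-homotopies.  Starting from
  \<open>k\<^sub>0 = g\<close>, lift the projection to \<open>B\<close> of each d-homotopy of the zigzag along \<open>p\<close> to get \<open>k\<^sub>i \<simeq> g\<close> with
  \<open>f \<circ> k\<^sub>i\<close> vertically homotopic to \<open>w\<^sub>i\<close>: the image under \<open>f\<close> of the lift and the given d-homotopy lie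
  over the same homotopy in \<open>B\<close> and agree at one end, hence at the other.  So \<open>k = k\<^sub>n\<close> is a right
  inverse of \<open>f\<close> up to vertical homotopy and still an ordinary homotopy inverse of \<open>f\<close>.  The same
  argument gives \<open>k\<close> a vertical right inverse \<open>l\<close>; then \<open>l \<simeq> f \<circ> k \<circ> l \<simeq> f\<close> vertically, so \<open>k\<close> is a
  two-sided inverse.
\<close>

section \<open>Calculus of d-maps: products, max and min on the interval, d-subspaces\<close>

lemma dmap_comp: "dmap Y Z g \<Longrightarrow> dmap X Y f \<Longrightarrow> dmap X Z (\<lambda>x. g (f x))"
  using dmap_compose[of X Y f Z g] by (simp add: o_def)

lemma dmap_cong:
  assumes "dmap X Y f" "\<And>x. x \<in> dpoints X \<Longrightarrow> g x = f x"
  shows "dmap X Y g"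
proof (rule dmapI)
  show "continuous_map (dtop X) (dtop Y) g"
    using dmap_cont[OF assms(1)] by (rule continuous_map_eq) (simp add: assms(2))
  show "(\<lambda>t. g (a t)) \<in> dpaths Y" if "a \<in> dpaths X" for a
    using dmap_path[OF assms(1) that] by (rule dpath_cong) (simp add: assms(2) dpath_in[OF that])
qed

lemma dmap_id: "dmap X X (\<lambda>x. x)"
  by (rule dmapI) auto

lemma dmap_const: "y \<in> dpoints Y \<Longrightarrow> dmap X Y (\<lambda>x. y)"
  by (rule dmapI) (auto simp: dpath_const)

lemma dmap_fst: "dmap (dprod X Y) X fst"
  by (rule dmapI) (auto simp: continuous_map_fst dpaths_dprod o_def)

lemma dmap_snd: "dmap (dprod X Y) Y snd"
  by (rule dmapI) (auto simp: continuous_map_snd dpaths_dprod o_def)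

lemma dmap_pair:
  assumes "dmap X Y f" "dmap X Z g"
  shows "dmap X (dprod Y Z) (\<lambda>x. (f x, g x))"
  by (rule dmapI)
     (use assms in \<open>auto simp: continuous_map_pairwise dpaths_dprod o_def dmap_cont dmap_path\<close>)

lemma dmap_dface: "\<alpha> \<in> {0..1} \<Longrightarrow> dmap X (dprod X dinterval) (dface \<alpha>)"
  using dmap_pair[OF dmap_id dmap_const, of \<alpha> dinterval X] by (simp add: dface_def[abs_def])

lemma dinterval_paths_max_min:
  assumes a: "a \<in> dinterval_paths" and b: "b \<in> dinterval_paths"
  shows "(\<lambda>t. max (a t) (b t)) \<in> dinterval_paths" "(\<lambda>t. min (a t) (b t)) \<in> dinterval_paths"
proof -
  have mono: "a r \<le> a s" "b r \<le> b s" if "r \<in> {0..1}" "s \<in> {0..1}" "r \<le> s" for r s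
    using a b that by (auto simp: dinterval_paths_iff mono_on_def)
  have cont: "continuous_on {0..1} a" "continuous_on {0..1} b"
    using a b by (auto simp: dinterval_paths_iff)
  have bounds: "max (a t) (b t) \<in> {0..1}" "min (a t) (b t) \<in> {0..1}" if "t \<in> {0..1}" for t
    using dinterval_path_bounds[OF a, of t] dinterval_path_bounds[OF b, of t] that by auto
  show "(\<lambda>t. max (a t) (b t)) \<in> dinterval_paths"
    unfolding dinterval_paths_iff
    by (intro conjI continuous_on_max cont image_subsetI bounds mono_onI max.mono mono)
  show "(\<lambda>t. min (a t) (b t)) \<in> dinterval_paths"
    unfolding dinterval_paths_iff
    by (intro conjI continuous_on_min cont image_subsetI bounds mono_onI min.mono mono)
qed

text \<open>Monotone in both arguments, hence directed, unlike the reversal of the interval. With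
  one argument as time, \<open>max\<close> joins the identity to the constant 1 and
  \<open>min\<close> the constant 0 to the identity; this is what moves a parameter to a chosen
  end.\<close>

lemma dmap_dinterval_max_min:
  shows "dmap (dprod dinterval dinterval) dinterval (\<lambda>z. max (fst z) (snd z))"
    and "dmap (dprod dinterval dinterval) dinterval (\<lambda>z. min (fst z) (snd z))"
  by (rule dmapI; auto simp: dpaths_dprod o_def dinterval_paths_max_min le_max_iff_disj min_le_iff_disj
        intro!: continuous_intros)+

text \<open>The initial structure for the inclusion of \<open>S\<close>, so that d-maps into it are
  the d-maps into \<open>X\<close> whose values on points lie in \<open>S\<close>. It serves to cut
  a pullback out of a product.\<close>

definition dsubspace :: "'a dspace \<Rightarrow> 'a set \<Rightarrow> 'a dspace" where
  "dsubspace X S = mk_dspace (subtopology (dtop X) S) {a \<in> dpaths X. \<forall>t\<in>{0..1}. a t \<in> S}"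

lemma is_dspace_dsubspace:
  "is_dspace (subtopology (dtop X) S) {a \<in> dpaths X. \<forall>t\<in>{0..1}. a t \<in> S}"
proof (rule is_dspaceI)
  fix a h assume "a \<in> {a \<in> dpaths X. \<forall>t\<in>{0..1}. a t \<in> S}" "h \<in> dinterval_paths"
  then show "a \<circ> h \<in> {a \<in> dpaths X. \<forall>t\<in>{0..1}. a t \<in> S}"
    using dpath_reparam[of a X h] dinterval_path_bounds[of h] by simp
next
  fix a b assume "a \<in> {a \<in> dpaths X. \<forall>t\<in>{0..1}. a t \<in> S}" "b \<in> {a \<in> dpaths X. \<forall>t\<in>{0..1}. a t \<in> S}" "a 1 = b 0"
  then show "dconcat a b \<in> {a \<in> dpaths X. \<forall>t\<in>{0..1}. a t \<in> S}"
    using dpath_concat[of a X b] by (simp add: dconcat_def)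
next
  fix a b assume "a \<in> {a \<in> dpaths X. \<forall>t\<in>{0..1}. a t \<in> S}" "\<And>t::real. 0 \<le> t \<Longrightarrow> t \<le> 1 \<Longrightarrow> b t = a t"
  then show "b \<in> {a \<in> dpaths X. \<forall>t\<in>{0..1}. a t \<in> S}"
    using dpath_cong[of a X b] by simp
next
  fix a assume "a \<in> {a \<in> dpaths X. \<forall>t\<in>{0..1}. a t \<in> S}"
  then show "pathin (subtopology (dtop X) S) a"
    using dpath_pathin[of a X] by (auto simp: pathin_def continuous_map_in_subtopology)
qed (auto simp: dpath_const)

lemma dtop_dsubspace [simp]: "dtop (dsubspace X S) = subtopology (dtop X) S"
  and dpaths_dsubspace: "dpaths (dsubspace X S) = {a \<in> dpaths X. \<forall>t\<in>{0..1}. a t \<in> S}"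
  by (simp_all add: dsubspace_def mk_dspace is_dspace_dsubspace)

lemma dmap_from_dsubspace: "dmap X Y f \<Longrightarrow> dmap (dsubspace X S) Y f"
  by (rule dmapI) (auto simp: dpaths_dsubspace dmap_path dmap_cont intro: continuous_map_from_subtopology)

lemma dmap_into_dsubspace:
  assumes "dmap X Y f" "\<And>x. x \<in> dpoints X \<Longrightarrow> f x \<in> S"
  shows "dmap X (dsubspace Y S) f"
  by (rule dmapI)
     (use assms in \<open>auto simp: dpaths_dsubspace dmap_path dmap_cont dpath_in continuous_map_in_subtopology\<close>)

section \<open>Vertical homotopy as a generated equivalence relation\<close>

text \<open>One directed homotopy of a zigzag. Verticality is measured against the step's own start
  \<open>u\<close>, not against the first map of the zigzag, so that zigzags become the equivalence
  closure of a binary relation.\<close>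

definition vdhomotopy_step ::
    "'x dspace \<Rightarrow> 'e dspace \<Rightarrow> ('e \<Rightarrow> 'b) \<Rightarrow> ('x \<Rightarrow> 'e) \<Rightarrow> ('x \<Rightarrow> 'e) \<Rightarrow> bool" where
  "vdhomotopy_step X E p u v \<longleftrightarrow> dmap X E u \<and> dmap X E v \<and>
     (\<exists>\<phi>. dhomotopy X E \<phi> u v \<and> (\<forall>x\<in>dpoints X. \<forall>t\<in>{0..1}. p (\<phi> (x, t)) = p (u x)))"

lemma vdhomotopy_step_over:
  assumes "vdhomotopy_step X E p u v" "x \<in> dpoints X"
  shows "p (v x) = p (u x)"
proof -
  obtain \<phi> where "dhomotopy X E \<phi> u v" and \<phi>: "\<forall>x\<in>dpoints X. \<forall>t\<in>{0..1}. p (\<phi> (x, t)) = p (u x)"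
    using assms(1) by (auto simp: vdhomotopy_step_def)
  then have "\<phi> (x, 1) = v x"
    using assms(2) by (simp add: dhomotopy_def dface_def)
  then show ?thesis using bspec[OF bspec[OF \<phi> assms(2)], of 1] by simp
qed

text \<open>All maps of a vertical zigzag have the same projection, so measuring a step against its
  own start or against \<open>f\<close> amounts to the same. The conjunct \<open>dmap X E f\<close>
  matters for the zigzag of length 0, which the closure allows at any function.\<close>

lemma vdhomotopic_iff:
  "vdhomotopic X E p f g \<longleftrightarrow> dmap X E f \<and> equivclp (vdhomotopy_step X E p) f g"
proof
  assume "vdhomotopic X E p f g"
  then obtain n :: nat and F where F: "F 0 = f" "F n = g"
    and F1: "\<And>i. i \<le> n \<Longrightarrow> dmap X E (F i)" "\<And>i x. i \<le> n \<Longrightarrow> x \<in> dpoints X \<Longrightarrow> p (F i x) = p (f x)"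
    and F2: "\<And>i. i < n \<Longrightarrow>
        \<exists>\<phi>. (dhomotopy X E \<phi> (F i) (F (Suc i)) \<or> dhomotopy X E \<phi> (F (Suc i)) (F i)) \<and>
            (\<forall>x\<in>dpoints X. \<forall>t\<in>{0..1}. p (\<phi> (x, t)) = p (f x))"
    unfolding vdhomotopic_def by blast
  have "symclp (vdhomotopy_step X E p) (F i) (F (Suc i))" if "i < n" for i
    using F2[OF that] F1[of i] F1[of "Suc i"] that
    unfolding symclp_def vdhomotopy_step_def by (metis Suc_leI less_imp_le)
  then have "(symclp (vdhomotopy_step X E p) ^^ n) f g"
    unfolding relpowp_fun_conv using F by blast
  then show "dmap X E f \<and> equivclp (vdhomotopy_step X E p) f g"
    using F1(1)[of 0] F by (auto simp: equivclp_def rtranclp_power)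
next
  assume asm: "dmap X E f \<and> equivclp (vdhomotopy_step X E p) f g"
  then obtain n F where F: "F 0 = f" "F n = g"
    and step: "\<And>i. i < n \<Longrightarrow> symclp (vdhomotopy_step X E p) (F i) (F (Suc i))"
    unfolding equivclp_def rtranclp_power relpowp_fun_conv by blast
  have F1: "dmap X E (F i) \<and> (\<forall>x\<in>dpoints X. p (F i x) = p (f x))" if "i \<le> n" for i
    using that
  proof (induction i)
    case (Suc i)
    then show ?case
      using step[of i] unfolding symclp_def
      by (metis Suc_le_eq less_imp_le vdhomotopy_step_def vdhomotopy_step_over)
  qed (use F asm in auto)
  have "\<exists>\<phi>. (dhomotopy X E \<phi> (F k) (F (Suc k)) \<or> dhomotopy X E \<phi> (F (Suc k)) (F k)) \<and>
      (\<forall>x\<in>dpoints X. \<forall>t\<in>{0..1}. p (\<phi> (x, t)) = p (f x))" if k: "k < n" for k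
    using step[OF k] F1[of k] F1[of "Suc k"] k
    unfolding symclp_def vdhomotopy_step_def by (metis Suc_leI less_imp_le)
  then show "vdhomotopic X E p f g"
    unfolding vdhomotopic_def using F F1 by blast
qed

lemma vdhomotopic_dmap:
  assumes "vdhomotopic X E p f g"
  shows "dmap X E f" "dmap X E g"
  using assms unfolding vdhomotopic_def by (metis le0, metis le_refl)

lemma vdhomotopic_over: "vdhomotopic X E p f g \<Longrightarrow> x \<in> dpoints X \<Longrightarrow> p (g x) = p (f x)"
  unfolding vdhomotopic_def by (metis le_refl)

lemma vdhomotopic_refl: "dmap X E f \<Longrightarrow> vdhomotopic X E p f f"
  by (simp add: vdhomotopic_iff)

lemma vdhomotopic_sym: "vdhomotopic X E p f g \<Longrightarrow> vdhomotopic X E p g f"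
  using vdhomotopic_dmap(2)[of X E p f g] by (auto simp: vdhomotopic_iff intro: equivclp_sym)

lemma vdhomotopic_trans [trans]:
  "vdhomotopic X E p f g \<Longrightarrow> vdhomotopic X E p g h \<Longrightarrow> vdhomotopic X E p f h"
  by (auto simp: vdhomotopic_iff intro: equivclp_trans)

text \<open>A single homotopy is read between any two of its ends. Leaving \<open>c\<close> and
  \<open>d\<close> free serves both orientations at once; \<open>c = d\<close> compares functions
  that agree on points but may differ elsewhere.\<close>

lemma vdhomotopicI:
  assumes H: "dmap (dprod X dinterval) E H"
    and over: "\<And>x t. x \<in> dpoints X \<Longrightarrow> 0 \<le> t \<Longrightarrow> t \<le> 1 \<Longrightarrow> p (H (x, t)) = b x"
    and cd: "c \<in> {0, 1}" "d \<in> {0, 1}"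
    and u: "dmap X E u" "\<And>x. x \<in> dpoints X \<Longrightarrow> H (x, c) = u x"
    and v: "dmap X E v" "\<And>x. x \<in> dpoints X \<Longrightarrow> H (x, d) = v x"
  shows "vdhomotopic X E p u v"
proof -
  have face: "dmap X E (\<lambda>x. H (x, c))" if "c \<in> {0, 1}" for c
    using dmap_comp[OF H dmap_dface] that by (auto simp: dface_def)
  have *: "vdhomotopic X E p u v"
    if "dmap X E u" "dmap X E v" "\<forall>x\<in>dpoints X. H (x, 0) = u x" "\<forall>x\<in>dpoints X. H (x, 1) = v x" for u v
  proof -
    have "dhomotopy X E H u v" using that H by (simp add: dhomotopy_def dface_def)
    moreover have "p (H (x, t)) = p (u x)" if "x \<in> dpoints X" "t \<in> {0..1}" for x t
      using over[of x t] over[of x 0] that \<open>\<forall>x\<in>dpoints X. H (x, 0) = u x\<close> by simp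
    ultimately have "vdhomotopy_step X E p u v"
      unfolding vdhomotopy_step_def using that by blast
    then show ?thesis using that by (auto simp: vdhomotopic_iff)
  qed
  \<comment> \<open>With equal ends \<open>u\<close> and \<open>v\<close> agree on points, and the
    stationary homotopy at \<open>u\<close> joins them.\<close>
  have const: "vdhomotopic X E p u v" if "c = d"
  proof -
    have "dmap (dprod X dinterval) E (\<lambda>z. u (fst z))" by (rule dmap_comp[OF u(1) dmap_fst])
    then have "dhomotopy X E (\<lambda>z. u (fst z)) u v"
      using u(2) v(2) that by (simp add: dhomotopy_def dface_def)
    then have "vdhomotopy_step X E p u v"
      unfolding vdhomotopy_step_def using u v by fastforce
    then show ?thesis using u by (auto simp: vdhomotopic_iff)
  qed
  consider "c = d" | "c = 0" "d = 1" | "c = 1" "d = 0" using cd by auto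
  then show ?thesis
    using const *[OF u(1) v(1)] vdhomotopic_sym[OF *[OF v(1) u(1)]] u(2) v(2) by cases simp_all
qed

lemma vdhomotopic_cong:
  assumes "dmap X E u" "\<And>x. x \<in> dpoints X \<Longrightarrow> v x = u x"
  shows "vdhomotopic X E p u v"
  by (rule vdhomotopicI[OF dmap_comp[OF assms(1) dmap_fst], where c = 0 and d = 0 and b = "\<lambda>x. p (u x)"])
     (use assms dmap_cong[OF assms] in auto)

text \<open>Induction along the zigzag reduces invariance of an operation \<open>G\<close> to a
  single directed homotopy. Since projections are constant along the zigzag, \<open>G\<close> has to
  be controlled only on maps with the projection of the initial \<open>u\<close>.\<close>

lemma vdhomotopic_map:
  assumes uv: "vdhomotopic X E p u v" and Gu: "dmap X F (G u)"
    and step: "\<And>\<eta> y z. \<lbrakk>dmap X E y; dmap X E z; dmap (dprod X dinterval) E \<eta>;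
        (\<And>x. x \<in> dpoints X \<Longrightarrow> \<eta> (x, 0) = y x); (\<And>x. x \<in> dpoints X \<Longrightarrow> \<eta> (x, 1) = z x);
        (\<And>x t. x \<in> dpoints X \<Longrightarrow> 0 \<le> t \<Longrightarrow> t \<le> 1 \<Longrightarrow> p (\<eta> (x, t)) = p (u x))\<rbrakk>
      \<Longrightarrow> vdhomotopic X F q (G y) (G z)"
  shows "vdhomotopic X F q (G u) (G v)"
proof -
  have "equivclp (vdhomotopy_step X E p) u v" using uv by (simp add: vdhomotopic_iff)
  then show ?thesis
  proof (induction rule: equivclp_induct)
    case base
    show ?case using Gu by (rule vdhomotopic_refl)
  next
    case (step y z)
    have u: "dmap X E u" using uv by (rule vdhomotopic_dmap)
    \<comment> \<open>Stated for any \<open>y\<close> and \<open>z\<close>, so that a step running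
      backwards is handled by exchanging them.\<close>
    have *: "vdhomotopic X F q (G y) (G z)"
      if st: "vdhomotopy_step X E p y z" and uy: "equivclp (vdhomotopy_step X E p) u y" for y z
    proof -
      obtain \<eta> where \<eta>: "dmap X E y" "dmap X E z" "dmap (dprod X dinterval) E \<eta>"
        "\<And>x. x \<in> dpoints X \<Longrightarrow> \<eta> (x, 0) = y x" "\<And>x. x \<in> dpoints X \<Longrightarrow> \<eta> (x, 1) = z x"
        "\<And>x t. x \<in> dpoints X \<Longrightarrow> 0 \<le> t \<Longrightarrow> t \<le> 1 \<Longrightarrow> p (\<eta> (x, t)) = p (y x)"
        using st by (auto simp: vdhomotopy_step_def dhomotopy_def dface_def)
      have "p (y x) = p (u x)" if "x \<in> dpoints X" for x
        using vdhomotopic_over[of X E p u y] uy u that by (simp add: vdhomotopic_iff)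
      with \<eta> show ?thesis by (intro assms(3)[of y z \<eta>]) simp_all
    qed
    have "equivclp (vdhomotopy_step X E p) u z"
      using step.hyps equivclp_into_equivclp by metis
    then have "vdhomotopic X F q (G y) (G z)"
      using step.hyps * vdhomotopic_sym by metis
    with step.IH show ?case by (rule vdhomotopic_trans)
  qed
qed

lemma vdhomotopic_postcompose:
  assumes k: "dmap E F k" "\<And>e. e \<in> dpoints E \<Longrightarrow> q (k e) = p e" and uv: "vdhomotopic X E p u v"
  shows "vdhomotopic X F q (k \<circ> u) (k \<circ> v)"
  using uv
proof (rule vdhomotopic_map)
  show "dmap X F (k \<circ> u)" using vdhomotopic_dmap(1)[OF uv] k(1) by (rule dmap_compose)
next
  fix \<eta> y z
  assume \<eta>: "dmap X E y" "dmap X E z" "dmap (dprod X dinterval) E \<eta>"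
    "\<And>x. x \<in> dpoints X \<Longrightarrow> \<eta> (x, 0) = y x" "\<And>x. x \<in> dpoints X \<Longrightarrow> \<eta> (x, 1) = z x"
    "\<And>x t. x \<in> dpoints X \<Longrightarrow> 0 \<le> t \<Longrightarrow> t \<le> 1 \<Longrightarrow> p (\<eta> (x, t)) = p (u x)"
  show "vdhomotopic X F q (k \<circ> y) (k \<circ> z)"
  proof (rule vdhomotopicI[OF dmap_comp[OF k(1) \<eta>(3)], where c = 0 and d = 1])
    show "q (k (\<eta> (x, t))) = p (u x)" if "x \<in> dpoints X" "0 \<le> t" "t \<le> 1" for x t
      using dmap_in[OF \<eta>(3), of "(x, t)"] \<eta>(6) that by (simp add: k(2))
  qed (use \<eta> k(1) in \<open>auto intro: dmap_compose\<close>)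
qed

section \<open>Uniqueness of lifts up to vertical homotopy\<close>

text \<open>The test d-space \<open>Z\<close> in the proof is the pullback of \<open>p\<close> along \<open>p \<circ> \<phi>\<close>.  Pushing all of it to the
  end \<open>1 - \<alpha>\<close> turns every lift of \<open>p \<circ> \<phi>\<close> into a vertical homotopy.\<close>

lemma weak_dlifting_unique:
  fixes X :: "'x dspace" and E :: "'e dspace" and B :: "'b dspace"
  assumes fib: "directed_weak_fibration E B p" and \<alpha>: "\<alpha> \<in> {0, 1}"
    and \<phi>: "dmap (dprod X dinterval) E \<phi>" and \<psi>: "dmap (dprod X dinterval) E \<psi>"
    and eq: "\<And>x t. x \<in> dpoints X \<Longrightarrow> 0 \<le> t \<Longrightarrow> t \<le> 1 \<Longrightarrow> p (\<psi> (x, t)) = p (\<phi> (x, t))"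
    and v: "vdhomotopic X E p (\<phi> \<circ> dface \<alpha>) (\<psi> \<circ> dface \<alpha>)"
  shows "vdhomotopic X E p (\<phi> \<circ> dface (1 - \<alpha>)) (\<psi> \<circ> dface (1 - \<alpha>))"
proof -
  let ?I = dinterval
  define \<beta> where "\<beta> = 1 - \<alpha>"
  have \<beta>: "\<beta> \<in> {0, 1}" using \<alpha> by (auto simp: \<beta>_def)
  have p: "dmap E B p" using fib by (simp add: directed_weak_fibration_def)
  define \<Phi> where "\<Phi> = p \<circ> \<phi>"
  have \<Phi>: "dmap (dprod X ?I) B \<Phi>" unfolding \<Phi>_def by (rule dmap_compose[OF \<phi> p])
  define Z where "Z = dsubspace (dprod X (dprod E ?I)) {(x, e, s). p e = \<Phi> (x, s)}"
  \<comment> \<open>\<open>m (s, _)\<close> is at \<open>s\<close> at time \<open>\<alpha>\<close>,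
    has reached \<open>\<beta>\<close> at time \<open>\<beta>\<close>, and stays at
    \<open>\<beta>\<close> throughout if \<open>s = \<beta>\<close>. \<open>max\<close> does this
    for \<open>\<alpha> = 0\<close> and \<open>min\<close> for \<open>\<alpha> = 1\<close>, both
    without reversing direction.\<close>
  define m where "m = (\<lambda>z::real \<times> real. if \<alpha> = 0 then max (fst z) (snd z) else min (fst z) (snd z))"
  have m: "dmap (dprod ?I ?I) ?I m"
    using dmap_dinterval_max_min by (cases "\<alpha> = 0") (simp_all add: m_def)
  have m_simps: "m (r, \<alpha>) = r" "m (r, \<beta>) = \<beta>" "m (\<beta>, r) = \<beta>" if "0 \<le> r" "r \<le> 1" for r
    using that \<alpha> by (auto simp: m_def \<beta>_def)
  have Z1: "dmap Z X fst" and Z2: "dmap Z E (\<lambda>z. fst (snd z))" and Z3: "dmap Z ?I (\<lambda>z. snd (snd z))"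
    unfolding Z_def
    by (intro dmap_from_dsubspace dmap_fst dmap_comp[OF dmap_fst dmap_snd] dmap_comp[OF dmap_snd dmap_snd])+
  have D: "dmap (dprod Z ?I) B (\<lambda>z. \<Phi> (fst (fst z), m (snd (snd (fst z)), snd z)))"
    by (intro dmap_comp[OF \<Phi>] dmap_pair dmap_comp[OF Z1 dmap_fst] dmap_comp[OF m]
          dmap_comp[OF Z3 dmap_fst] dmap_snd)
  have start: "\<forall>z\<in>dpoints Z. ((\<lambda>z. \<Phi> (fst (fst z), m (snd (snd (fst z)), snd z))) \<circ> dface \<alpha>) z =
      (p \<circ> (\<lambda>z. fst (snd z))) z"
    by (auto simp: Z_def dface_def m_simps)
  \<comment> \<open>This one lift is chosen from \<open>\<Phi>\<close> alone. It moves a point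
    \<open>e\<close> over \<open>\<Phi> (x, s)\<close> to a point over
    \<open>\<Phi> (x, \<beta>)\<close>; at time \<open>\<alpha>\<close> it is only vertically
    homotopic to the projection to \<open>e\<close>.\<close>
  obtain \<Theta> where \<Theta>: "dmap (dprod Z ?I) E \<Theta>"
      "\<And>z. z \<in> dpoints (dprod Z ?I) \<Longrightarrow> p (\<Theta> z) = \<Phi> (fst (fst z), m (snd (snd (fst z)), snd z))"
    and \<Theta>\<alpha>: "vdhomotopic Z E p (\<Theta> \<circ> dface \<alpha>) (\<lambda>z. fst (snd z))"
    using directed_weak_fibration_lifting[OF fib, of Z, unfolded weak_dlifting_def,
        THEN spec, THEN spec, THEN bspec, OF \<alpha>, THEN mp, OF Z2, THEN mp, OF D, THEN mp, OF start] by blast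
  have intoZ: "dmap Y Z (\<lambda>y. (k y, w y, s y))"
    if "dmap Y X k" "dmap Y E w" "dmap Y ?I s" "\<And>y. y \<in> dpoints Y \<Longrightarrow> p (w y) = \<Phi> (k y, s y)"
    for Y :: "'y dspace" and k w s
    unfolding Z_def using that by (intro dmap_into_dsubspace dmap_pair) auto
  \<comment> \<open>\<open>G\<close> carries maps over \<open>\<Phi> (_, \<alpha>)\<close> to maps
    over \<open>\<Phi> (_, \<beta>)\<close>. It sees only the end \<open>\<alpha>\<close> of a lift,
    which is how two lifts with vertically homotopic ends there become comparable.\<close>
  define G where "G w = (\<lambda>x. \<Theta> ((x, w x, \<alpha>), \<beta>))" for w
  have const: "dmap Y ?I (\<lambda>y. c)" if "c \<in> {0, 1}" for c and Y :: "'y dspace"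
    using that by (intro dmap_const) auto
  \<comment> \<open>Either disjunct gives \<open>m (s, r) = \<beta>\<close>. Along both of these
    edges of the parameter square \<open>\<Theta>\<close> stays, for fixed \<open>x\<close>, over
    one point of the base, so it yields vertical homotopies there.\<close>
  have pushed: "p (\<Theta> ((x, e, s), r)) = \<Phi> (x, \<beta>)"
    if "x \<in> dpoints X" "e \<in> dpoints E" "0 \<le> s" "s \<le> 1" "0 \<le> r" "r \<le> 1" "p e = \<Phi> (x, s)" "s = \<beta> \<or> r = \<beta>"
    for x e s r
    using \<Theta>(2)[of "((x, e, s), r)"] that by (auto simp: Z_def m_simps)
  have G_dmap: "dmap X E (G w)"
    if "dmap X E w" "\<And>x. x \<in> dpoints X \<Longrightarrow> p (w x) = \<Phi> (x, \<alpha>)" for w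
    unfolding G_def using that \<alpha> \<beta> by (intro dmap_comp[OF \<Theta>(1)] dmap_pair intoZ const dmap_id)
  have G_cong: "vdhomotopic X E p (G u) (G v)"
    if uv: "vdhomotopic X E p u v" and u: "\<And>x. x \<in> dpoints X \<Longrightarrow> p (u x) = \<Phi> (x, \<alpha>)" for u v
    using uv
  proof (rule vdhomotopic_map)
    show "dmap X E (G u)" using vdhomotopic_dmap(1)[OF uv] u by (rule G_dmap)
  next
    fix \<eta> y z
    assume \<eta>: "dmap X E y" "dmap X E z" "dmap (dprod X dinterval) E \<eta>"
      "\<And>x. x \<in> dpoints X \<Longrightarrow> \<eta> (x, 0) = y x" "\<And>x. x \<in> dpoints X \<Longrightarrow> \<eta> (x, 1) = z x"
      "\<And>x t. x \<in> dpoints X \<Longrightarrow> 0 \<le> t \<Longrightarrow> t \<le> 1 \<Longrightarrow> p (\<eta> (x, t)) = p (u x)"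
    have yz: "p (y x) = \<Phi> (x, \<alpha>)" "p (z x) = \<Phi> (x, \<alpha>)" if "x \<in> dpoints X" for x
      using \<eta>(4-)[OF that] u[OF that] by (metis order_refl zero_le_one)+
    have "dmap (dprod X ?I) E (\<lambda>y. \<Theta> ((fst y, \<eta> y, \<alpha>), \<beta>))"
      using \<alpha> \<beta> \<eta>(3) by (intro dmap_comp[OF \<Theta>(1)] dmap_pair intoZ const dmap_fst) (auto simp: \<eta>(6) u)
    then show "vdhomotopic X E p (G y) (G z)"
    proof (rule vdhomotopicI[where c = 0 and d = 1])
      show "p (\<Theta> ((fst (x, t), \<eta> (x, t), \<alpha>), \<beta>)) = \<Phi> (x, \<beta>)" if "x \<in> dpoints X" "0 \<le> t" "t \<le> 1" for x t
        using that dmap_in[OF \<eta>(3), of "(x, t)"] \<alpha> \<beta> by (simp, intro pushed) (auto simp: \<eta>(6) u)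
    qed (use \<eta> yz G_dmap in \<open>auto simp: G_def\<close>)
  qed
  \<comment> \<open>Here \<open>\<phi>\<close> is rebound to an arbitrary lift of
    \<open>\<Phi>\<close>, so that the claim covers both given lifts. In the square of parameters
    \<open>(s, r)\<close>, go along \<open>r = \<beta>\<close> from \<open>s = \<alpha>\<close> to
    \<open>s = \<beta>\<close> while \<open>e\<close> follows \<open>\<phi>\<close>, then along
    \<open>s = \<beta>\<close> from \<open>r = \<beta>\<close> to \<open>r = \<alpha>\<close>, where
    \<open>\<Theta>\<close> is vertically homotopic to the projection to \<open>e\<close>. The map
    \<open>j\<close> marks the edge \<open>s = \<beta>\<close>.\<close>
  have transport: "vdhomotopic X E p (G (\<phi> \<circ> dface \<alpha>)) (\<phi> \<circ> dface \<beta>)"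
    if \<phi>: "dmap (dprod X ?I) E \<phi>"
      and over: "\<And>x t. x \<in> dpoints X \<Longrightarrow> 0 \<le> t \<Longrightarrow> t \<le> 1 \<Longrightarrow> p (\<phi> (x, t)) = \<Phi> (x, t)" for \<phi>
  proof -
    have face: "dmap X E (\<phi> \<circ> dface c)" if "c \<in> {0, 1}" for c
      using that by (intro dmap_compose[OF dmap_dface \<phi>]) auto
    have face_over: "p ((\<phi> \<circ> dface c) x) = \<Phi> (x, c)" if "c \<in> {0, 1}" "x \<in> dpoints X" for c x
      using that over[of x c] by (auto simp: dface_def)
    define j where "j x = (x, (\<phi> \<circ> dface \<beta>) x, \<beta>)" for x
    have j: "dmap X Z j"
      unfolding j_def by (rule intoZ[OF dmap_id face[OF \<beta>] const[OF \<beta>] face_over[OF \<beta>]])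
    have face_in: "\<phi> (x, t) \<in> dpoints E" if "x \<in> dpoints X" "0 \<le> t" "t \<le> 1" for x t
      using that dmap_in[OF \<phi>, of "(x, t)"] by simp
    have \<Theta>j: "dmap X E (\<lambda>x. \<Theta> (j x, c))" if "c \<in> {0, 1}" for c
      using that by (intro dmap_comp[OF \<Theta>(1)] dmap_pair j const)
    have "dmap (dprod X ?I) E (\<lambda>y. \<Theta> ((fst y, \<phi> y, snd y), \<beta>))"
      using \<beta> \<phi> by (intro dmap_comp[OF \<Theta>(1)] dmap_pair intoZ const dmap_fst dmap_snd) (auto simp: over)
    then have "vdhomotopic X E p (G (\<phi> \<circ> dface \<alpha>)) (\<lambda>x. \<Theta> (j x, \<beta>))"
    proof (rule vdhomotopicI[OF _ _ \<alpha> \<beta>])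
      show "p (\<Theta> ((fst (x, t), \<phi> (x, t), snd (x, t)), \<beta>)) = \<Phi> (x, \<beta>)"
        if "x \<in> dpoints X" "0 \<le> t" "t \<le> 1" for x t
        using that \<beta> face_in[OF that] by (simp, intro pushed) (auto simp: over)
      show "dmap X E (G (\<phi> \<circ> dface \<alpha>))" using face face_over \<alpha> by (intro G_dmap) auto
    qed (use \<Theta>j \<beta> in \<open>auto simp: G_def j_def dface_def\<close>)
    also have "vdhomotopic X E p (\<lambda>x. \<Theta> (j x, \<beta>)) (\<lambda>x. \<Theta> (j x, \<alpha>))"
    proof (rule vdhomotopicI[OF _ _ \<beta> \<alpha>])
      show "dmap (dprod X ?I) E (\<lambda>y. \<Theta> (j (fst y), snd y))"
        by (intro dmap_comp[OF \<Theta>(1)] dmap_pair dmap_comp[OF j] dmap_fst dmap_snd)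
      show "p (\<Theta> (j (fst (x, t)), snd (x, t))) = \<Phi> (x, \<beta>)" if "x \<in> dpoints X" "0 \<le> t" "t \<le> 1" for x t
        using that \<beta> by (simp add: j_def dface_def, intro pushed) (auto simp: over face_in)
    qed (use \<Theta>j \<alpha> \<beta> in auto)
    also have "vdhomotopic X E p (\<lambda>x. \<Theta> (j x, \<alpha>)) (\<phi> \<circ> dface \<beta>)"
      using vdhomotopic_precompose[OF j \<Theta>\<alpha>] by (simp add: o_def dface_def j_def)
    finally show ?thesis .
  qed
  have "vdhomotopic X E p (G (\<phi> \<circ> dface \<alpha>)) (\<phi> \<circ> dface \<beta>)"
    by (rule transport[OF \<phi>]) (simp add: \<Phi>_def)
  moreover have "vdhomotopic X E p (G (\<psi> \<circ> dface \<alpha>)) (\<psi> \<circ> dface \<beta>)"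
    by (rule transport[OF \<psi>]) (simp add: \<Phi>_def eq)
  moreover have "vdhomotopic X E p (G (\<phi> \<circ> dface \<alpha>)) (G (\<psi> \<circ> dface \<alpha>))"
    by (rule G_cong[OF v]) (simp add: \<Phi>_def dface_def)
  ultimately show ?thesis
    unfolding \<beta>_def by (meson vdhomotopic_sym vdhomotopic_trans)
qed

section \<open>Ordinary homotopy, lifting of zigzags and the equivalence\<close>

text \<open>Over a one-point base every homotopy is vertical, so the results on vertical homotopy
  also serve ordinary homotopy.\<close>

lemma dhomotopic_iff:
  "dhomotopic X Y f g \<longleftrightarrow> vdhomotopic X Y (\<lambda>_. ()) f g"
proof -
  have "vdhomotopy_step X Y (\<lambda>_. ()) = (\<lambda>u v. dmap X Y u \<and> dmap X Y v \<and> (\<exists>\<phi>. dhomotopy X Y \<phi> u v))"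
    by (simp add: vdhomotopy_step_def fun_eq_iff)
  then show ?thesis
    using vdhomotopic_dmap(2)[of X Y "\<lambda>_. ()" f g] by (auto simp: dhomotopic_def vdhomotopic_iff)
qed

text \<open>Rereading each single homotopy over the one-point base is the case of
  \<open>vdhomotopic_map\<close> where \<open>G\<close> is the identity and the target projection is
  constant.\<close>

lemma vdhomotopic_imp_dhomotopic:
  assumes "vdhomotopic X E p f g"
  shows "dhomotopic X E f g"
  unfolding dhomotopic_iff using assms
proof (rule vdhomotopic_map[where G = "\<lambda>u. u"])
  show "dmap X E f" using assms by (rule vdhomotopic_dmap)
qed (rule vdhomotopicI[where c = 0 and d = 1 and b = "\<lambda>_. ()"], assumption, simp_all)

text \<open>Corrects \<open>g\<close> within its ordinary homotopy class. The conclusion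
  \<open>dhomotopic X E k g\<close> keeps \<open>k\<close> an ordinary homotopy inverse when
  \<open>g\<close> is one; the second application, with \<open>k\<close> in place of
  \<open>f\<close>, relies on this.\<close>

lemma dhomotopic_lift:
  assumes fib: "directed_weak_fibration E B p" and fib': "directed_weak_fibration E' B p'"
    and f: "dmap E E' f" "\<And>x. x \<in> dpoints E \<Longrightarrow> p' (f x) = p x"
    and g: "dmap X E g" and w: "dhomotopic X E' (f \<circ> g) w"
  obtains k where "dmap X E k" "vdhomotopic X E' p' (f \<circ> k) w" "dhomotopic X E k g"
proof -
  have "equivclp (vdhomotopy_step X E' (\<lambda>_. ())) (f \<circ> g) w"
    using w by (simp add: dhomotopic_iff vdhomotopic_iff)
  then have "\<exists>k. dmap X E k \<and> vdhomotopic X E' p' (f \<circ> k) w \<and> dhomotopic X E k g"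
  proof (induction rule: equivclp_induct)
    case base
    show ?case
      using g dmap_compose[OF g f(1)] unfolding dhomotopic_iff by (blast intro: vdhomotopic_refl)
  next
    case (step y z)
    then obtain k where k: "dmap X E k" "vdhomotopic X E' p' (f \<circ> k) y" "dhomotopic X E k g"
      by blast
    have yz: "dmap X E' y" "dmap X E' z"
      using step.hyps(2) by (auto simp: vdhomotopy_step_def)
    \<comment> \<open>The orientation of the step is stored in \<open>\<alpha>\<close>: it is 1 if
      the homotopy runs from \<open>z\<close> to \<open>y\<close>. Backward steps of the zigzag are
      lifted from the end 1.\<close>
    obtain W \<alpha> where W: "dmap (dprod X dinterval) E' W" and \<alpha>: "\<alpha> \<in> {0, 1}"
      and y: "\<And>x. x \<in> dpoints X \<Longrightarrow> W (x, \<alpha>) = y x" and z: "\<And>x. x \<in> dpoints X \<Longrightarrow> W (x, 1 - \<alpha>) = z x"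
    proof -
      consider W where "dhomotopy X E' W y z" | W where "dhomotopy X E' W z y"
        using step.hyps(2) by (auto simp: vdhomotopy_step_def)
      then show ?thesis
      proof cases
        case (1 W)
        then show ?thesis by (intro that[of W 0]) (auto simp: dhomotopy_def dface_def)
      next
        case (2 W)
        then show ?thesis by (intro that[of W 1]) (auto simp: dhomotopy_def dface_def)
      qed
    qed
    have p': "dmap E' B p'" using fib' by (simp add: directed_weak_fibration_def)
    have lift: "weak_dlifting X E B p" by (rule directed_weak_fibration_lifting[OF fib])
    have "\<forall>x\<in>dpoints X. ((p' \<circ> W) \<circ> dface \<alpha>) x = (p \<circ> k) x"
      using vdhomotopic_over[OF k(2)] y f(2) dmap_in[OF k(1)] by (simp add: dface_def)
    then obtain \<kappa> where \<kappa>: "dmap (dprod X dinterval) E \<kappa>"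
        "\<And>z. z \<in> dpoints (dprod X dinterval) \<Longrightarrow> p (\<kappa> z) = (p' \<circ> W) z"
      and \<kappa>\<alpha>: "vdhomotopic X E p (\<kappa> \<circ> dface \<alpha>) k"
      using lift[unfolded weak_dlifting_def, THEN spec, THEN spec, THEN bspec, OF \<alpha>, THEN mp, OF k(1),
          THEN mp, OF dmap_compose[OF W p'], THEN mp] by blast
    have face: "dmap X (dprod X dinterval) (dface c)" if "c = \<alpha> \<or> c = 1 - \<alpha>" for c
      using that \<alpha> by (intro dmap_dface) auto
    have "vdhomotopic X E' p' (f \<circ> \<kappa> \<circ> dface (1 - \<alpha>)) (W \<circ> dface (1 - \<alpha>))"
    proof (rule weak_dlifting_unique[OF fib' \<alpha> dmap_compose[OF \<kappa>(1) f(1)] W])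
      show "p' (W (x, t)) = p' ((f \<circ> \<kappa>) (x, t))" if "x \<in> dpoints X" "0 \<le> t" "t \<le> 1" for x t
        using \<kappa>(2)[of "(x, t)"] f(2) dmap_in[OF \<kappa>(1), of "(x, t)"] that by simp
      have "vdhomotopic X E' p' (f \<circ> (\<kappa> \<circ> dface \<alpha>)) (f \<circ> k)"
        by (rule vdhomotopic_postcompose[OF f \<kappa>\<alpha>])
      also note k(2)
      also have "vdhomotopic X E' p' y (W \<circ> dface \<alpha>)"
        by (rule vdhomotopic_cong[OF yz(1)]) (simp add: dface_def y)
      finally show "vdhomotopic X E' p' (f \<circ> \<kappa> \<circ> dface \<alpha>) (W \<circ> dface \<alpha>)"
        by (simp add: comp_assoc)
    qed
    also have "vdhomotopic X E' p' (W \<circ> dface (1 - \<alpha>)) z"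
      by (rule vdhomotopic_sym[OF vdhomotopic_cong[OF yz(2)]]) (simp add: dface_def z)
    finally have 1: "vdhomotopic X E' p' (f \<circ> (\<kappa> \<circ> dface (1 - \<alpha>))) z"
      by (simp add: comp_assoc)
    \<comment> \<open>The next map is the end \<open>1 - \<alpha>\<close> of
      \<open>\<kappa>\<close>. As \<open>\<kappa>\<close> need not be vertical, its two ends are
      compared over the one-point base only.\<close>
    have "vdhomotopic X E (\<lambda>_. ()) (\<kappa> \<circ> dface (1 - \<alpha>)) (\<kappa> \<circ> dface \<alpha>)"
      by (rule vdhomotopicI[OF \<kappa>(1), where c = "1 - \<alpha>" and d = \<alpha>])
         (use \<alpha> dmap_compose[OF face \<kappa>(1)] in \<open>auto simp: dface_def\<close>)
    moreover have "dhomotopic X E (\<kappa> \<circ> dface \<alpha>) k"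
      using \<kappa>\<alpha> by (rule vdhomotopic_imp_dhomotopic)
    ultimately have "dhomotopic X E (\<kappa> \<circ> dface (1 - \<alpha>)) g"
      using k(3) unfolding dhomotopic_iff by (meson vdhomotopic_trans)
    with 1 dmap_compose[OF face \<kappa>(1)] show ?case by blast
  qed
  with that show ?thesis by blast
qed

theorem theorem6p2:
  fixes E :: "'e dspace" and E' :: "'f dspace" and B :: "'b dspace"
    and p :: "'e \<Rightarrow> 'b" and p' :: "'f \<Rightarrow> 'b" and f :: "'e \<Rightarrow> 'f"
  assumes "directed_weak_fibration E B p"
    and "directed_weak_fibration E' B p'"
    and "dmap E E' f"
    and "\<forall>x\<in>dpoints E. p' (f x) = p x"
  shows "directed_fibre_homotopy_equivalence E E' p p' f \<longleftrightarrow> directed_homotopy_equivalence E E' f"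
proof
  assume "directed_fibre_homotopy_equivalence E E' p p' f"
  then show "directed_homotopy_equivalence E E' f"
    unfolding directed_fibre_homotopy_equivalence_def directed_homotopy_equivalence_def
    by (blast intro: vdhomotopic_imp_dhomotopic)
next
  assume "directed_homotopy_equivalence E E' f"
  then obtain g where g: "dmap E' E g" and gf: "dhomotopic E E (g \<circ> f) id"
    and fg: "dhomotopic E' E' (f \<circ> g) id"
    unfolding directed_homotopy_equivalence_def by blast
  have f: "p' (f x) = p x" if "x \<in> dpoints E" for x
    using assms(4) that by blast
  obtain k where k: "dmap E' E k" and fk: "vdhomotopic E' E' p' (f \<circ> k) id" and kg: "dhomotopic E' E k g"
    using dhomotopic_lift[OF assms(1-3) f g fg] .
  \<comment> \<open>\<open>g\<close> is not assumed to lie over \<open>B\<close>; that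
    \<open>k\<close> does follows from the vertical homotopy between \<open>f \<circ> k\<close> and
    the identity.\<close>
  have k_over: "p (k y) = p' y" if "y \<in> dpoints E'" for y
    using vdhomotopic_over[OF fk that] f[OF dmap_in[OF k that]] by simp
  \<comment> \<open>\<open>k \<circ> f\<close> is homotopic to \<open>g \<circ> f\<close>, hence to
    the identity. This zigzag is now lifted along \<open>p'\<close>, with \<open>k\<close> as the
    map over \<open>B\<close> and \<open>f\<close> in the role of \<open>g\<close>.\<close>
  have "dhomotopic E E (k \<circ> f) id"
    using vdhomotopic_precompose[OF assms(3), of E "\<lambda>_. ()" k g] kg gf
    unfolding dhomotopic_iff by (blast intro: vdhomotopic_trans)
  then obtain l where l: "dmap E E' l" and kl: "vdhomotopic E E p (k \<circ> l) id"
    using dhomotopic_lift[OF assms(2,1) k k_over assms(3)] by metis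
  have "vdhomotopic E E' p' l (f \<circ> k \<circ> l)"
    using vdhomotopic_precompose[OF l fk] by (simp add: vdhomotopic_sym)
  also have "vdhomotopic E E' p' (f \<circ> k \<circ> l) f"
    using vdhomotopic_postcompose[where q = p', OF assms(3) f kl] by (simp add: comp_assoc)
  finally have lf: "vdhomotopic E E' p' l f" .
  have "vdhomotopic E E p (k \<circ> f) (k \<circ> l)"
    by (rule vdhomotopic_sym[OF vdhomotopic_postcompose[where q = p, OF k k_over lf]])
  also note kl
  finally have "vdhomotopic E E p (k \<circ> f) id" .
  then show "directed_fibre_homotopy_equivalence E E' p p' f"
    unfolding directed_fibre_homotopy_equivalence_def using assms(3,4) k k_over fk by blast
qed

end
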